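(* There exists an absolute constant $\varepsilon_0>0$ such that for every $k\geq 1$ there exists $n=n(k)$ and a reference distribution $\mathbf{q}$ over $[k]$ such that any algorithm solving $\mathrm{BinIdentity}(n,\mathbf{q},k,\varepsilon_0)$ must use at least $k/2^{O(\sqrt{\log k})}$ samples.
   Context: $\log$ denotes the binary logarithm. For integers $n,k\geq 1$, let $\mathcal{J}_{n,k}$ denote the set of all ordered partitions $(I_1,\dots,I_k)$ of $[n]$ into $k$ pairwise disjoint consecutive intervals (listed in increasing order), each possibly empty. Given a distribution $\mathbf{q}$ over $[k]$, let $\mathcal{P}_{\mathbf{q}}$ be the set of distributions $\mathbf{p}'$ over $[n]$ for which there exists $(I_1,\dots,I_k)\in\mathcal{J}_{n,k}$ with $\mathbf{p}'(I_j)=\mathbf{q}(j)$ for all $j$. Let $d_{TV}(\mathbf{p},\mathcal{P}_{\mathbf{q}})=\min_{\mathbf{p}'\in\mathcal{P}_{\mathbf{q}}}\frac12\sum_i|\mathbf{p}(i)-\mathbf{p}'(i)|$. The problem $\mathrm{BinIdentity}(n,\mathbf{q},k,\varepsilon)$: given i.i.d. samples from an unknown distribution $\mathbf{p}$ over $[n]$, accept with probability at least $2/3$ if $\mathbf{p}\in\mathcal{P}_{\mathbf{q}}$ and reject with probability at least $2/3$ if $d_{TV}(\mathbf{p},\mathcal{P}_{\mathbf{q}})>\varepsilon$. *)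

theory Defs
  imports Complex_Main
begin

definition is_distr :: "nat \<Rightarrow> (nat \<Rightarrow> real) \<Rightarrow> bool" where
  "is_distr n p \<longleftrightarrow> (\<forall>i\<in>{1..n}. 0 \<le> p i) \<and> (\<Sum>i\<in>{1..n}. p i) = 1"

definition interval_partitions :: "nat \<Rightarrow> nat \<Rightarrow> (nat \<Rightarrow> nat set) set" where
  "interval_partitions n k =
     {I. \<exists>b :: nat \<Rightarrow> nat. b 0 = 0 \<and> b k = n \<and> (\<forall>j<k. b j \<le> b (Suc j)) \<and>
           (\<forall>j\<in>{1..k}. I j = {b (j - 1)<..b j}) \<and> (\<forall>j. j \<notin> {1..k} \<longrightarrow> I j = {})}"

definition P_q :: "nat \<Rightarrow> nat \<Rightarrow> (nat \<Rightarrow> real) \<Rightarrow> (nat \<Rightarrow> real) set" where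
  "P_q n k q = {p'. is_distr n p' \<and>
       (\<exists>I\<in>interval_partitions n k. \<forall>j\<in>{1..k}. (\<Sum>i\<in>I j. p' i) = q j)}"

definition dTV_set :: "nat \<Rightarrow> (nat \<Rightarrow> real) \<Rightarrow> (nat \<Rightarrow> real) set \<Rightarrow> real" where
  "dTV_set n p P = Inf ((\<lambda>p'. (1/2) * (\<Sum>i\<in>{1..n}. \<bar>p i - p' i\<bar>)) ` P)"

text \<open>A (possibly randomized) tester using m i.i.d. samples is a function T giving the
  acceptance probability for each sample sequence xs in [n]^m.\<close>

definition accept_prob :: "nat \<Rightarrow> nat \<Rightarrow> (nat \<Rightarrow> real) \<Rightarrow> (nat list \<Rightarrow> real) \<Rightarrow> real" where
  "accept_prob n m p T =
     (\<Sum>xs\<in>{xs. length xs = m \<and> set xs \<subseteq> {1..n}}. prod_list (map p xs) * T xs)"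

definition solves_BinIdentity ::
  "nat \<Rightarrow> (nat \<Rightarrow> real) \<Rightarrow> nat \<Rightarrow> real \<Rightarrow> nat \<Rightarrow> (nat list \<Rightarrow> real) \<Rightarrow> bool" where
  "solves_BinIdentity n q k \<epsilon> m T \<longleftrightarrow>
     (\<forall>xs. 0 \<le> T xs \<and> T xs \<le> 1) \<and>
     (\<forall>p. is_distr n p \<and> p \<in> P_q n k q \<longrightarrow> accept_prob n m p T \<ge> 2/3) \<and>
     (\<forall>p. is_distr n p \<and> dTV_set n p (P_q n k q) > \<epsilon> \<longrightarrow> accept_prob n m p T \<le> 1/3)"

end

theory Submission
  imports Defs "HOL-Computational_Algebra.Polynomial" "HOL-Library.FuncSet"
begin

text \<open>
  The domain is split into many blocks of equal mass, and in every block the reference distribution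
  consists of one coarse bin, a zone of fine bins, and one more coarse bin. A block that spreads its
  atoms as units fits; a block with atoms of size 16 over the zone of fine bins does not, wherever the
  bins are put, because a fine bin cannot hold such an atom.

  The two kinds of blocks are made indistinguishable from at most \<open>D\<close> samples. With the atoms at
  random positions, the likelihood of \<open>D\<close> samples is a polynomial of degree at most \<open>D\<close> in the atom
  size, so the kinds agree up to exponentially small corrections supported on much larger atoms.
  Blocks with these larger atoms would not fit either, but they are replaced by blocks in which a
  large shift moves the atoms out of the fine zone. The likelihood is also a polynomial of degree at
  most \<open>D\<close> in the shift, and extrapolating from the large shifts to the shift \<open>0\<close> costs a factor
  \<open>24 ^ D\<close> only, which is absorbed by the smallness of the corrections.

  With \<open>D\<close> about \<open>sqrt (log 2 k)\<close>, a block uses \<open>2 ^ O(D)\<close> bins, and \<open>k / 2 ^ O(D)\<close> samples rarely put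
  more than \<open>D\<close> samples in the same block.
\<close>

section \<open>Signed combinations of point evaluations of polynomials\<close>

text \<open>The polynomial is the product of \<open>1 - x / 16 ^ d\<close> over
  \<open>d = 1..D\<close>. Its weighted coefficient sum is at most the product of the factors
  \<open>1 + 4 / 16 ^ d\<close>. The slack \<open>1 / 16 ^ D\<close> closes the induction: with
  \<open>c = 1 / 16 ^ Suc D\<close>, \<open>(2 - 16 * c) * (1 + 4 * c) \<le> 2 - c\<close>. What
  matters later is the bound \<open>2\<close>.\<close>

lemma geometric_annihilator:
  "\<exists>P::real poly. degree P \<le> D \<and> coeff P 0 = 1 \<and> (\<forall>d\<in>{1..D}. poly P (16 ^ d) = 0) \<and>
     (\<Sum>i\<le>D. \<bar>coeff P i\<bar> * 4 ^ i) \<le> 2 - 1 / 16 ^ D"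
proof (induction D)
  case 0
  show ?case by (rule exI[of _ 1]) auto
next
  case (Suc D)
  then obtain P :: "real poly" where P: "degree P \<le> D" "coeff P 0 = 1"
    "\<And>d. d \<in> {1..D} \<Longrightarrow> poly P (16 ^ d) = 0" "(\<Sum>i\<le>D. \<bar>coeff P i\<bar> * 4 ^ i) \<le> 2 - 1 / 16 ^ D"
    by blast
  define c :: real where "c = 1 / 16 ^ Suc D"
  define P' where "P' = [:1, - c:] * P"
  have c: "c * 16 ^ Suc D = 1" "c > 0" by (auto simp: c_def)
  have co: "coeff P' i = coeff P i - (if i = 0 then 0 else c * coeff P (i - 1))" for i
    by (cases i) (auto simp: P'_def coeff_pCons)
  have "degree P' \<le> Suc D"
    unfolding P'_def by (rule order.trans[OF degree_mult_le]) (use P in auto)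
  moreover have "coeff P' 0 = 1" using P by (simp add: co)
  moreover have "poly P' (16 ^ d) = 0" if "d \<in> {1..Suc D}" for d
    using that c P(3)[of d] by (cases "d = Suc D") (auto simp: P'_def algebra_simps)
  moreover have "(\<Sum>i\<le>Suc D. \<bar>coeff P' i\<bar> * 4 ^ i) \<le> 2 - 1 / 16 ^ Suc D"
  proof -
    have "(\<Sum>i\<le>Suc D. \<bar>coeff P' i\<bar> * 4 ^ i)
        \<le> (\<Sum>i\<le>Suc D. \<bar>coeff P i\<bar> * 4 ^ i + (if i = 0 then 0 else c * \<bar>coeff P (i - 1)\<bar> * 4 ^ i))"
    proof (rule sum_mono)
      fix i assume "i \<in> {..Suc D}"
      have "\<bar>coeff P' i\<bar> \<le> \<bar>coeff P i\<bar> + (if i = 0 then 0 else c * \<bar>coeff P (i - 1)\<bar>)"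
        using c abs_triangle_ineq4[of "coeff P i" "c * coeff P (i - 1)"] by (auto simp: co abs_mult)
      then have "\<bar>coeff P' i\<bar> * 4 ^ i \<le> (\<bar>coeff P i\<bar> + (if i = 0 then 0 else c * \<bar>coeff P (i - 1)\<bar>)) * 4 ^ i"
        by (rule mult_right_mono) simp
      then show "\<bar>coeff P' i\<bar> * 4 ^ i \<le> \<bar>coeff P i\<bar> * 4 ^ i + (if i = 0 then 0 else c * \<bar>coeff P (i - 1)\<bar> * 4 ^ i)"
        by (simp add: algebra_simps split: if_splits)
    qed
    also have "\<dots> = (\<Sum>i\<le>Suc D. \<bar>coeff P i\<bar> * 4 ^ i) + (\<Sum>i\<le>D. c * \<bar>coeff P i\<bar> * 4 ^ Suc i)"
      by (simp only: sum.distrib sum.atMost_Suc_shift) simp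
    also have "(\<Sum>i\<le>Suc D. \<bar>coeff P i\<bar> * 4 ^ i) = (\<Sum>i\<le>D. \<bar>coeff P i\<bar> * 4 ^ i)"
      using P(1) by (simp add: coeff_eq_0)
    also have "(\<Sum>i\<le>D. c * \<bar>coeff P i\<bar> * 4 ^ Suc i) = 4 * c * (\<Sum>i\<le>D. \<bar>coeff P i\<bar> * 4 ^ i)"
      by (simp add: sum_distrib_left mult_ac)
    also have "(\<Sum>i\<le>D. \<bar>coeff P i\<bar> * 4 ^ i) + 4 * c * (\<Sum>i\<le>D. \<bar>coeff P i\<bar> * 4 ^ i)
        \<le> (2 - 1 / 16 ^ D) + 4 * c * (2 - 1 / 16 ^ D)"
      using P(4) c by (intro add_mono mult_left_mono) auto
    also have "\<dots> \<le> 2 - 1 / 16 ^ Suc D"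
    proof -
      have "1 / 16 ^ D = 16 * c" by (simp add: c_def)
      moreover have "1 / 16 ^ Suc D = c" by (simp add: c_def)
      moreover have "c * c > 0" using c(2) by simp
      ultimately show ?thesis using c(2) by (simp only: algebra_simps)
    qed
    finally show ?thesis .
  qed
  ultimately show ?case by (intro exI[of _ P']) auto
qed

text \<open>Starting from the trivial evaluation at \<open>1\<close>, each induction step eliminates
  the smallest node \<open>16 ^ \<gamma>\<close> with a shifted multiple of the annihilator. The
  shifted annihilator gives \<open>0\<close> on \<open>g\<close>, because its value is a combination
  of the \<open>poly P (16 ^ d)\<close> with \<open>d\<close> in \<open>{1..D}\<close>, the term
  \<open>d = 0\<close> dropping out by \<open>poly g 0 = 0\<close>. The weights \<open>4 ^ i\<close>
  turn the invariant bound \<open>1\<close> into an unweighted sum of size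
  \<open>4 ^ (- \<gamma>)\<close>.\<close>

lemma geometric_extrapolation:
  "\<exists>C::nat \<Rightarrow> real. (\<forall>i. C i \<noteq> 0 \<longrightarrow> i \<in> {\<gamma>..\<gamma> + D}) \<and> (\<Sum>i\<le>\<gamma> + D. \<bar>C i\<bar> * 4 ^ i) \<le> 1 \<and>
     (\<forall>g::real poly. degree g \<le> D \<longrightarrow> poly g 0 = 0 \<longrightarrow>
        poly g 1 = (\<Sum>i\<le>\<gamma> + D. C i * poly g (16 ^ i)))"
proof (induction \<gamma>)
  case 0
  show ?case
    by (rule exI[of _ "\<lambda>i. if i = 0 then 1 else 0"])
      (auto simp: if_distrib[of "\<lambda>x. x * _"] if_distrib[of abs] cong: if_cong)
next
  case (Suc \<gamma>)
  then obtain C :: "nat \<Rightarrow> real" where C: "\<And>i. C i \<noteq> 0 \<Longrightarrow> i \<in> {\<gamma>..\<gamma> + D}"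
    "(\<Sum>i\<le>\<gamma> + D. \<bar>C i\<bar> * 4 ^ i) \<le> 1"
    "\<And>g::real poly. degree g \<le> D \<Longrightarrow> poly g 0 = 0 \<Longrightarrow> poly g 1 = (\<Sum>i\<le>\<gamma> + D. C i * poly g (16 ^ i))"
    by blast
  obtain P :: "real poly" where P: "degree P \<le> D" "coeff P 0 = 1"
    "\<And>d. d \<in> {1..D} \<Longrightarrow> poly P (16 ^ d) = 0" "(\<Sum>i\<le>D. \<bar>coeff P i\<bar> * 4 ^ i) \<le> 2 - 1 / 16 ^ D"
    using geometric_annihilator by blast
  \<comment> \<open>Since \<open>coeff P 0 = 1\<close>, the coefficient at \<open>\<gamma>\<close>
    cancels. This frees weight \<open>\<bar>C \<gamma>\<bar> * 4 ^ \<gamma>\<close>, and the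
    remaining coefficients of \<open>P\<close> add back at most \<open>2 - 1\<close> times as much,
    so the weighted sum does not grow.\<close>
  define C' where "C' = (\<lambda>i. C i - (if \<gamma> \<le> i then C \<gamma> * coeff P (i - \<gamma>) else 0))"
  have C'0: "C' i = 0" if "i \<le> \<gamma>" for i
    using that C(1)[of i] P(2) by (cases "i = \<gamma>") (auto simp: C'_def)
  have C'_D: "C' i = 0" if "i > \<gamma> + D" for i
    using that C(1)[of i] P(1) by (auto simp: C'_def coeff_eq_0)
  have supp: "\<forall>i. C' i \<noteq> 0 \<longrightarrow> i \<in> {Suc \<gamma>..Suc \<gamma> + D}"
    using C'0 C'_D by (metis Suc_leI add_Suc atLeastAtMost_iff le_SucI not_less)
  have split: "(\<Sum>i\<le>\<gamma> + D. if \<gamma> \<le> i then h (i - \<gamma>) else 0) = (\<Sum>i\<le>D. h i)" for h :: "nat \<Rightarrow> real"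
  proof -
    have "(\<Sum>i\<le>\<gamma> + D. if \<gamma> \<le> i then h (i - \<gamma>) else 0) = (\<Sum>i\<in>{\<gamma>..\<gamma> + D}. h (i - \<gamma>))"
      by (rule sum.mono_neutral_cong_right) auto
    also have "\<dots> = (\<Sum>i\<le>D. h i)"
      by (rule sum.reindex_bij_witness[of _ "\<lambda>i. i + \<gamma>" "\<lambda>i. i - \<gamma>"]) auto
    finally show ?thesis .
  qed
  have "poly g 1 = (\<Sum>i\<le>Suc \<gamma> + D. C' i * poly g (16 ^ i))"
    if g: "degree g \<le> D" "poly g 0 = 0" for g :: "real poly"
  proof -
    have expand: "poly p x = (\<Sum>i\<le>D. coeff p i * x ^ i)" if "degree p \<le> D" for p :: "real poly" and x
      unfolding poly_altdef using that
      by (intro sum.mono_neutral_left) (auto simp: coeff_eq_0)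
    have null: "(\<Sum>i\<le>D. coeff P i * poly g (16 ^ (i + \<gamma>))) = 0"
    proof -
      have "(\<Sum>i\<le>D. coeff P i * poly g (16 ^ (i + \<gamma>)))
          = (\<Sum>i\<le>D. \<Sum>d\<le>D. coeff P i * (coeff g d * (16 ^ (i + \<gamma>)) ^ d))"
        by (simp add: expand[OF g(1)] sum_distrib_left)
      also have "\<dots> = (\<Sum>d\<le>D. \<Sum>i\<le>D. coeff P i * (coeff g d * (16 ^ (i + \<gamma>)) ^ d))"
        by (rule sum.swap)
      also have "\<dots> = (\<Sum>d\<le>D. coeff g d * 16 ^ (\<gamma> * d) * poly P (16 ^ d))"
        by (simp add: expand[OF P(1)] sum_distrib_left power_add power_mult_distrib
            mult_ac flip: power_mult)
      also have "\<dots> = 0"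
      proof (intro sum.neutral ballI)
        fix d assume "d \<in> {..D}"
        then show "coeff g d * 16 ^ (\<gamma> * d) * poly P (16 ^ d) = 0"
          using P(3)[of d] g(2) by (cases "d = 0") (auto simp: poly_0_coeff_0)
      qed
      finally show ?thesis .
    qed
    have "(\<Sum>i\<le>Suc \<gamma> + D. C' i * poly g (16 ^ i)) = (\<Sum>i\<le>\<gamma> + D. C' i * poly g (16 ^ i))"
      using C'_D by simp
    also have "\<dots> = (\<Sum>i\<le>\<gamma> + D. C i * poly g (16 ^ i)
        - (if \<gamma> \<le> i then C \<gamma> * (coeff P (i - \<gamma>) * poly g (16 ^ (i - \<gamma> + \<gamma>))) else 0))"
      by (intro sum.cong) (auto simp: C'_def algebra_simps)
    also have "\<dots> = poly g 1 - (\<Sum>i\<le>D. C \<gamma> * (coeff P i * poly g (16 ^ (i + \<gamma>))))"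
      unfolding sum_subtractf by (subst split) (simp add: C(3) g)
    finally show ?thesis using null by (simp flip: sum_distrib_left)
  qed
  moreover have "(\<Sum>i\<le>Suc \<gamma> + D. \<bar>C' i\<bar> * 4 ^ i) \<le> 1"
  proof -
    have "(\<Sum>i\<le>Suc \<gamma> + D. \<bar>C' i\<bar> * 4 ^ i) = (\<Sum>i\<le>\<gamma> + D. \<bar>C' i\<bar> * 4 ^ i)"
      using C'_D by simp
    also have "\<dots> \<le> (\<Sum>i\<le>\<gamma> + D. \<bar>C i\<bar> * 4 ^ i - (if i = \<gamma> then 2 * \<bar>C \<gamma>\<bar> * 4 ^ \<gamma> else 0)
        + (if \<gamma> \<le> i then \<bar>C \<gamma>\<bar> * 4 ^ \<gamma> * (\<bar>coeff P (i - \<gamma>)\<bar> * 4 ^ (i - \<gamma>)) else 0))"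
    proof (rule sum_mono)
      fix i
      show "\<bar>C' i\<bar> * 4 ^ i \<le> \<bar>C i\<bar> * 4 ^ i - (if i = \<gamma> then 2 * \<bar>C \<gamma>\<bar> * 4 ^ \<gamma> else 0)
        + (if \<gamma> \<le> i then \<bar>C \<gamma>\<bar> * 4 ^ \<gamma> * (\<bar>coeff P (i - \<gamma>)\<bar> * 4 ^ (i - \<gamma>)) else 0)"
      proof (cases "i \<le> \<gamma>")
        case True
        then show ?thesis using C'0[of i] P(2) by auto
      next
        case False
        have "\<bar>C' i\<bar> \<le> \<bar>C i\<bar> + \<bar>C \<gamma>\<bar> * \<bar>coeff P (i - \<gamma>)\<bar>"
          using False abs_triangle_ineq4[of "C i" "C \<gamma> * coeff P (i - \<gamma>)"]
          by (simp add: C'_def abs_mult)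
        then have "\<bar>C' i\<bar> * 4 ^ i \<le> (\<bar>C i\<bar> + \<bar>C \<gamma>\<bar> * \<bar>coeff P (i - \<gamma>)\<bar>) * 4 ^ i"
          by (rule mult_right_mono) simp
        moreover have "(4::real) ^ i = 4 ^ \<gamma> * 4 ^ (i - \<gamma>)"
          using False by (simp flip: power_add)
        ultimately show ?thesis using False by (simp add: algebra_simps)
      qed
    qed
    also have "\<dots> = (\<Sum>i\<le>\<gamma> + D. \<bar>C i\<bar> * 4 ^ i) - 2 * \<bar>C \<gamma>\<bar> * 4 ^ \<gamma>
        + \<bar>C \<gamma>\<bar> * 4 ^ \<gamma> * (\<Sum>i\<le>D. \<bar>coeff P i\<bar> * 4 ^ i)"
      unfolding sum.distrib sum_subtractf by (subst split) (simp add: sum_distrib_left)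
    also have "\<dots> \<le> 1 - 2 * \<bar>C \<gamma>\<bar> * 4 ^ \<gamma> + \<bar>C \<gamma>\<bar> * 4 ^ \<gamma> * 2"
      using P(4) by (intro add_mono diff_mono C(2) mult_left_mono order.refl)
        (auto intro: order.trans)
    finally show ?thesis by simp
  qed
  ultimately show ?case using supp by blast
qed

text \<open>The previous extrapolation is applied to \<open>g x = f x - f (16 * x)\<close>, which
  vanishes at \<open>0\<close>; collecting the evaluations of \<open>f\<close> makes
  \<open>K\<close> the difference of \<open>C\<close> and its shift by one. So atom sizes
  \<open>1\<close> and \<open>16\<close> differ only by a correction of total size
  \<open>2 / 4 ^ \<gamma>\<close> on much larger sizes.\<close>

lemma geometric_near_equivalence:
  "\<exists>K::nat \<Rightarrow> real. (\<forall>i. K i \<noteq> 0 \<longrightarrow> i \<in> {\<gamma>..\<gamma> + D + 1}) \<and>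
     (\<Sum>i\<le>\<gamma> + D + 1. \<bar>K i\<bar>) \<le> 2 / 4 ^ \<gamma> \<and>
     (\<forall>f::real poly. degree f \<le> D \<longrightarrow>
        poly f 1 - poly f 16 = (\<Sum>i\<le>\<gamma> + D + 1. K i * poly f (16 ^ i)))"
proof -
  obtain C :: "nat \<Rightarrow> real" where C: "\<And>i. C i \<noteq> 0 \<Longrightarrow> i \<in> {\<gamma>..\<gamma> + D}"
    "(\<Sum>i\<le>\<gamma> + D. \<bar>C i\<bar> * 4 ^ i) \<le> 1"
    "\<And>g::real poly. degree g \<le> D \<Longrightarrow> poly g 0 = 0 \<Longrightarrow> poly g 1 = (\<Sum>i\<le>\<gamma> + D. C i * poly g (16 ^ i))"
    using geometric_extrapolation by blast
  define K where "K = (\<lambda>i. C i - (if i = 0 then 0 else C (i - 1)))"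
  have big: "C i = 0" if "i > \<gamma> + D" for i using C(1)[of i] that by fastforce
  have shift: "(\<Sum>i\<le>Suc n. h i * (if i = 0 then 0 else c (i - 1))) = (\<Sum>i\<le>n. h (Suc i) * c i)"
    for h c :: "nat \<Rightarrow> real" and n
    by (simp only: sum.atMost_Suc_shift) simp
  have small: "(\<Sum>i\<le>\<gamma> + D. \<bar>C i\<bar>) \<le> 1 / 4 ^ \<gamma>"
  proof -
    have "(\<Sum>i\<le>\<gamma> + D. \<bar>C i\<bar>) * 4 ^ \<gamma> = (\<Sum>i\<le>\<gamma> + D. \<bar>C i\<bar> * 4 ^ \<gamma>)"
      by (simp add: sum_distrib_right)
    also have "\<dots> \<le> (\<Sum>i\<le>\<gamma> + D. \<bar>C i\<bar> * 4 ^ i)"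
    proof (rule sum_mono)
      fix i show "\<bar>C i\<bar> * 4 ^ \<gamma> \<le> \<bar>C i\<bar> * 4 ^ i"
        using C(1)[of i] by (cases "C i = 0") (auto intro!: mult_left_mono)
    qed
    finally show ?thesis using C(2) by (simp add: field_simps)
  qed
  have "(\<Sum>i\<le>\<gamma> + D + 1. \<bar>K i\<bar>) \<le> (\<Sum>i\<le>Suc (\<gamma> + D). \<bar>C i\<bar> + 1 * (if i = 0 then 0 else \<bar>C (i - 1)\<bar>))"
    by (simp del: sum.atMost_Suc, intro sum_mono) (auto simp: K_def)
  also have "\<dots> = 2 * (\<Sum>i\<le>\<gamma> + D. \<bar>C i\<bar>)"
    unfolding sum.distrib by (subst shift[of "\<lambda>_. 1"]) (simp add: big)
  finally have 1: "(\<Sum>i\<le>\<gamma> + D + 1. \<bar>K i\<bar>) \<le> 2 / 4 ^ \<gamma>" using small by simp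
  have 2: "poly f 1 - poly f 16 = (\<Sum>i\<le>\<gamma> + D + 1. K i * poly f (16 ^ i))"
    if f: "degree f \<le> D" for f :: "real poly"
  proof -
    define g where "g = f - pcompose f [:0, 16:]"
    have "degree g \<le> D" unfolding g_def using f
      by (intro degree_diff_le) (auto simp: degree_pcompose)
    then have "poly g 1 = (\<Sum>i\<le>\<gamma> + D. C i * poly g (16 ^ i))"
      by (intro C(3)) (auto simp: g_def poly_pcompose)
    also have "\<dots> = (\<Sum>i\<le>\<gamma> + D. C i * poly f (16 ^ i)) - (\<Sum>i\<le>\<gamma> + D. poly f (16 ^ Suc i) * C i)"
      by (simp add: g_def poly_pcompose algebra_simps sum_subtractf)
    also have "\<dots> = (\<Sum>i\<le>Suc (\<gamma> + D). K i * poly f (16 ^ i))"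
      unfolding shift[of "\<lambda>i. poly f (16 ^ i)", symmetric] K_def left_diff_distrib sum_subtractf
      by (simp add: big mult.commute)
    finally show ?thesis by (simp add: g_def poly_pcompose)
  qed
  have 3: "\<forall>i. K i \<noteq> 0 \<longrightarrow> i \<in> {\<gamma>..\<gamma> + D + 1}"
  proof (intro allI impI)
    fix i assume "K i \<noteq> 0"
    then have "C i \<noteq> 0 \<or> i \<noteq> 0 \<and> C (i - 1) \<noteq> 0" by (auto simp: K_def split: if_splits)
    then show "i \<in> {\<gamma>..\<gamma> + D + 1}" using C(1)[of i] C(1)[of "i - 1"] by auto
  qed
  show ?thesis using 1 2 3 by blast
qed

text \<open>Lagrange interpolation at \<open>D + 1\<close> equally spaced nodes of the interval from
  \<open>2\<close> to \<open>3\<close>, evaluated at \<open>0\<close>. The numerators are at most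
  \<open>3 ^ D\<close>, and the node distances contribute
  \<open>D ^ D / (fact l * fact (D - l))\<close>, whose sum over \<open>l\<close> is
  \<open>2 ^ D * D ^ D / fact D\<close>.\<close>

lemma extrapolate_to_zero:
  assumes D: "D > 0"
  shows "\<exists>L::nat \<Rightarrow> real. (\<Sum>l\<le>D. \<bar>L l\<bar>) \<le> 24 ^ D \<and>
     (\<forall>f::real poly. degree f \<le> D \<longrightarrow> poly f 0 = (\<Sum>l\<le>D. L l * poly f (2 + real l / real D)))"
proof -
  define x where "x = (\<lambda>l::nat. 2 + real l / real D)"
  have x_diff: "x i - x l = (real i - real l) / real D" for i l by (simp add: x_def diff_divide_distrib)
  have inj: "x i = x l \<longleftrightarrow> i = l" for i l using D by (auto simp: x_def)
  define B where "B = (\<lambda>l. \<Prod>i\<in>{..D} - {l}. smult (1 / (x l - x i)) [:- x i, 1:])"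
  define L where "L = (\<lambda>l. poly (B l) 0)"
  have degB: "degree (B l) \<le> D" if "l \<le> D" for l
  proof -
    have "degree (B l) \<le> (\<Sum>i\<in>{..D} - {l}. degree (smult (1 / (x l - x i)) [:- x i, 1:]))"
      unfolding B_def by (rule degree_prod_sum_le[unfolded comp_def]) auto
    also have "\<dots> \<le> (\<Sum>i\<in>{..D} - {l}. 1)"
      by (rule sum_mono) (auto intro: order.trans[OF degree_smult_le])
    finally show ?thesis using that by simp
  qed
  have polyB: "poly (B l) (x j) = (if j = l then 1 else 0)" if "l \<le> D" "j \<le> D" for l j
  proof (cases "j = l")
    case True
    then show ?thesis using inj
      by (auto simp: B_def poly_prod simp flip: diff_divide_distrib intro!: prod.neutral)
  next
    case False
    then show ?thesis using that by (auto simp: B_def poly_prod intro!: prod_zero bexI[of _ j])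
  qed
  have "poly f 0 = (\<Sum>l\<le>D. L l * poly f (x l))" if f: "degree f \<le> D" for f :: "real poly"
  proof -
    have "f = (\<Sum>l\<le>D. smult (poly f (x l)) (B l))" (is "_ = ?g")
    proof (rule poly_eqI_degree[of "x ` {..D}"])
      have card: "card (x ` {..D}) = Suc D"
        by (subst card_image) (auto simp: inj_on_def inj)
      show "degree f < card (x ` {..D})" using f card by simp
      have "degree ?g \<le> D"
        by (rule degree_sum_le) (use degB in \<open>auto intro: order.trans[OF degree_smult_le]\<close>)
      then show "degree ?g < card (x ` {..D})" using card by simp
      show "poly f y = poly ?g y" if "y \<in> x ` {..D}" for y
        using that polyB by (auto simp: poly_sum if_distrib[of "\<lambda>z. _ * z"] cong: if_cong)
    qed
    then have "poly f 0 = poly ?g 0" by simp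
    then show ?thesis by (simp add: poly_sum L_def mult.commute)
  qed
  moreover have "(\<Sum>l\<le>D. \<bar>L l\<bar>) \<le> 24 ^ D"
  proof -
    have fact_prod: "(\<Prod>i\<in>{..D} - {l}. \<bar>real l - real i\<bar>) = fact l * fact (D - l)" if "l \<le> D" for l
    proof -
      have "(\<Prod>i\<in>{..D} - {l}. \<bar>real l - real i\<bar>)
          = (\<Prod>i\<in>{..<l} \<union> {l<..D}. \<bar>real l - real i\<bar>)"
        using that by (intro prod.cong) auto
      also have "\<dots> = (\<Prod>i<l. \<bar>real l - real i\<bar>) * (\<Prod>i\<in>{l<..D}. \<bar>real l - real i\<bar>)"
        by (rule prod.union_disjoint) auto
      also have "(\<Prod>i<l. \<bar>real l - real i\<bar>) = (\<Prod>i\<in>{1..l}. real i)"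
        by (rule prod.reindex_bij_witness[of _ "\<lambda>i. l - i" "\<lambda>i. l - i"]) auto
      also have "(\<Prod>i\<in>{l<..D}. \<bar>real l - real i\<bar>) = (\<Prod>i\<in>{1..D - l}. real i)"
        by (rule prod.reindex_bij_witness[of _ "\<lambda>i. i + l" "\<lambda>i. i - l"]) auto
      finally show ?thesis by (simp add: fact_prod)
    qed
    have Lb: "\<bar>L l\<bar> \<le> (3 * real D) ^ D / (fact l * fact (D - l))" if l: "l \<le> D" for l
    proof -
      have "\<bar>L l\<bar> = (\<Prod>i\<in>{..D} - {l}. (real D * x i) / \<bar>real l - real i\<bar>)"
      proof -
        have "\<bar>x i / (x l - x i)\<bar> = real D * x i / \<bar>real l - real i\<bar>" for i
          using D by (simp add: x_diff abs_divide) (simp add: x_def)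
        then show ?thesis by (simp add: L_def B_def poly_prod abs_prod)
      qed
      also have "\<dots> = (\<Prod>i\<in>{..D} - {l}. real D * x i) / (fact l * fact (D - l))"
        by (simp add: prod_dividef fact_prod l)
      also have "(\<Prod>i\<in>{..D} - {l}. real D * x i) \<le> (\<Prod>i\<in>{..D} - {l}. 3 * real D)"
        using D by (intro prod_mono) (auto simp: x_def field_simps)
      also have "(\<Prod>i\<in>{..D} - {l}. 3 * real D) = (3 * real D) ^ D" using l by simp
      finally show ?thesis by (simp add: divide_right_mono)
    qed
    \<comment> \<open>\<open>D ^ D / fact D\<close> is a single term of the series of
      \<open>exp D\<close>.\<close>
    have pow: "real D ^ D \<le> 4 ^ D * fact D"
    proof -
      have "real D ^ D / fact D \<le> exp (real D)"
      proof -
        have "(\<lambda>n. real D ^ n / fact n) sums exp (real D)"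
          using exp_converges[of "real D"] by (simp add: divide_inverse_commute scaleR_conv_of_real)
        then show ?thesis
          using sum_le_suminf[of "\<lambda>n. real D ^ n / fact n" "{D}"] by (auto simp: sums_iff)
      qed
      also have "exp (real D) = exp 1 ^ D" by (simp flip: exp_of_nat_mult)
      also have "\<dots> \<le> 4 ^ D" using exp_le by (intro power_mono) auto
      finally show ?thesis by (simp add: field_simps)
    qed
    have "(\<Sum>l\<le>D. \<bar>L l\<bar>) \<le> (\<Sum>l\<le>D. (3 * real D) ^ D / (fact l * fact (D - l)))"
      by (rule sum_mono) (use Lb in auto)
    also have "\<dots> = (\<Sum>l\<le>D. (3 * real D) ^ D / fact D * real (D choose l))"
      by (rule sum.cong) (auto simp: binomial_fact)
    also have "\<dots> = (3 * real D) ^ D / fact D * 2 ^ D"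
      unfolding sum_distrib_left[symmetric] of_nat_sum[symmetric] by (simp add: choose_row_sum)
    also have "\<dots> = 6 ^ D * (real D ^ D / fact D)"
    proof -
      have "(6::real) ^ D = 3 ^ D * 2 ^ D" by (simp flip: power_mult_distrib)
      then show ?thesis by (simp add: power_mult_distrib)
    qed
    also have "\<dots> \<le> 6 ^ D * 4 ^ D"
      using pow by (intro mult_left_mono) (auto simp: field_simps)
    also have "\<dots> = 24 ^ D" by (simp flip: power_mult_distrib)
    finally show ?thesis .
  qed
  ultimately show ?thesis unfolding x_def by blast
qed

section \<open>Samples from independent blocks\<close>

lemma sum_lists_prod_list:
  fixes f :: "'a \<Rightarrow> 'b :: comm_semiring_1"
  assumes "finite A"
  shows "(\<Sum>xs\<in>{xs. length xs = m \<and> set xs \<subseteq> A}. prod_list (map f xs)) = sum f A ^ m"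
proof (induction m)
  case 0
  have "{xs. length xs = 0 \<and> set xs \<subseteq> A} = {[]}" by auto
  then show ?case by simp
next
  case (Suc m)
  let ?L = "{xs. length xs = m \<and> set xs \<subseteq> A}"
  have "{xs. length xs = Suc m \<and> set xs \<subseteq> A} = (\<lambda>(x, xs). x # xs) ` (A \<times> ?L)"
    by (auto simp: length_Suc_conv)
  then have "(\<Sum>xs\<in>{xs. length xs = Suc m \<and> set xs \<subseteq> A}. prod_list (map f xs))
      = (\<Sum>(x, xs)\<in>A \<times> ?L. f x * prod_list (map f xs))"
    by (simp add: sum.reindex inj_on_def case_prod_unfold)
  also have "\<dots> = sum f A * (\<Sum>xs\<in>?L. prod_list (map f xs))"
    by (simp add: sum_product sum.cartesian_product)
  finally show ?case using Suc by simp
qed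

lemma finite_sample_lists: "finite {xs :: nat list. length xs = m \<and> set xs \<subseteq> {1..n}}"
  using finite_lists_length_eq[of "{1..n}" m] by (simp add: conj_commute)

lemma sum_UN_le:
  fixes f :: "'a \<Rightarrow> real"
  assumes "finite I" "\<And>i. i \<in> I \<Longrightarrow> finite (A i)" "\<And>i x. i \<in> I \<Longrightarrow> x \<in> A i \<Longrightarrow> f x \<ge> 0"
  shows "sum f (\<Union>i\<in>I. A i) \<le> (\<Sum>i\<in>I. sum f (A i))"
  using assms
proof (induction I rule: finite_induct)
  case (insert j I)
  have "sum f (A j \<union> (\<Union>i\<in>I. A i)) \<le> sum f (A j) + sum f (\<Union>i\<in>I. A i)"
    using insert by (subst sum_Un) (auto intro!: sum_nonneg)
  also have "sum f (\<Union>i\<in>I. A i) \<le> (\<Sum>i\<in>I. sum f (A i))"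
    using insert by blast
  finally show ?case using insert by simp
qed auto

lemma prod_list_nonneg_on:
  fixes f :: "'a \<Rightarrow> real"
  shows "(\<And>x. x \<in> set xs \<Longrightarrow> f x \<ge> 0) \<Longrightarrow> prod_list (map f xs) \<ge> 0"
  by (induction xs) auto

text \<open>Markov's inequality for \<open>z ^ (number of samples satisfying P)\<close>.\<close>

lemma many_hits_bound:
  fixes p :: "nat \<Rightarrow> real"
  assumes p: "\<And>i. i \<in> {1..n} \<Longrightarrow> p i \<ge> 0" "sum p {1..n} = 1"
    and P: "sum p {i\<in>{1..n}. P i} = \<beta>" and z: "z \<ge> 1"
  shows "(\<Sum>xs\<in>{xs. (length xs = m \<and> set xs \<subseteq> {1..n}) \<and> d \<le> length (filter P xs)}. prod_list (map p xs))
    \<le> (1 + (z - 1) * \<beta>) ^ m / z ^ d"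
proof -
  let ?L = "{xs. length xs = m \<and> set xs \<subseteq> {1..n}}"
  \<comment> \<open>Tilting the density by \<open>z\<close> on the points satisfying
    \<open>P\<close> turns the generating function of the hit count into a plain power of
    \<open>sum f\<close>.\<close>
  define f where "f = (\<lambda>i. p i * (if P i then z else 1))"
  have f: "prod_list (map f xs) = prod_list (map p xs) * z ^ length (filter P xs)" for xs
    by (induction xs) (auto simp: f_def)
  have "(\<Sum>xs\<in>{xs. (length xs = m \<and> set xs \<subseteq> {1..n}) \<and> d \<le> length (filter P xs)}. prod_list (map p xs))
      \<le> (\<Sum>xs\<in>{xs. (length xs = m \<and> set xs \<subseteq> {1..n}) \<and> d \<le> length (filter P xs)}.
            prod_list (map f xs) / z ^ d)"
  proof (rule sum_mono)
    fix xs assume xs: "xs \<in> {xs. (length xs = m \<and> set xs \<subseteq> {1..n}) \<and> d \<le> length (filter P xs)}"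
    have "prod_list (map p xs) \<ge> 0" using xs p by (intro prod_list_nonneg_on) auto
    then have "prod_list (map p xs) * z ^ d \<le> prod_list (map p xs) * z ^ length (filter P xs)"
      using xs z by (intro mult_left_mono power_increasing) auto
    then show "prod_list (map p xs) \<le> prod_list (map f xs) / z ^ d"
      using z by (simp add: f field_simps)
  qed
  also have "\<dots> \<le> (\<Sum>xs\<in>?L. prod_list (map f xs) / z ^ d)"
    using finite_sample_lists[of m n] p z
    by (intro sum_mono2 divide_nonneg_nonneg prod_list_nonneg_on) (auto simp: f_def)
  also have "\<dots> = sum f {1..n} ^ m / z ^ d"
    by (simp add: sum_lists_prod_list flip: sum_divide_distrib)
  also have "sum f {1..n} = (\<Sum>i\<in>{1..n}. p i) + (z - 1) * sum p {i\<in>{1..n}. P i}"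
  proof -
    have "sum f {1..n} = (\<Sum>i\<in>{1..n}. p i + (z - 1) * (if P i then p i else 0))"
      by (intro sum.cong) (auto simp: f_def algebra_simps)
    also have "\<dots> = (\<Sum>i\<in>{1..n}. p i) + (z - 1) * (\<Sum>i\<in>{1..n}. if P i then p i else 0)"
      by (simp add: sum.distrib sum_distrib_left)
    also have "(\<Sum>i\<in>{1..n}. if P i then p i else 0) = sum p {i\<in>{1..n}. P i}"
      by (rule sum.mono_neutral_cong_right) auto
    finally show ?thesis .
  qed
  finally show ?thesis using p P by simp
qed

text \<open>A domain of \<open>b\<close> consecutive blocks of \<open>cs\<close> points each, every block of total mass
  \<open>1 / b\<close>; \<open>\<omega>\<close> assigns a state to every block.\<close>

definition block_density :: "nat \<Rightarrow> nat \<Rightarrow> ('z \<Rightarrow> nat \<Rightarrow> real) \<Rightarrow> (nat \<Rightarrow> 'z) \<Rightarrow> nat \<Rightarrow> real" where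
  "block_density b cs \<mu> \<omega> i = \<mu> (\<omega> ((i - 1) div cs)) ((i - 1) mod cs) / real b"

lemma sum_over_blocks:
  fixes f :: "nat \<Rightarrow> nat \<Rightarrow> 'a::comm_monoid_add"
  shows "(\<Sum>i\<in>{1..b * cs}. f ((i - 1) div cs) ((i - 1) mod cs)) = (\<Sum>a<b. \<Sum>u<cs. f a u)"
proof (cases "cs = 0")
  case False
  have "(\<Sum>i\<in>{1..b * cs}. f ((i - 1) div cs) ((i - 1) mod cs)) = (\<Sum>(a, u)\<in>{..<b} \<times> {..<cs}. f a u)"
  proof (rule sum.reindex_bij_witness[of _ "\<lambda>(a, u). a * cs + u + 1" "\<lambda>i. ((i - 1) div cs, (i - 1) mod cs)"])
    fix x assume "x \<in> {..<b} \<times> {..<cs}"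
    then obtain a u where x: "x = (a, u)" "a < b" "u < cs" by auto
    have "a * cs + u + 1 \<le> a * cs + cs" using x by simp
    also have "\<dots> = Suc a * cs" by simp
    also have "\<dots> \<le> b * cs" using x by (intro mult_le_mono1) auto
    finally show "(case x of (a, u) \<Rightarrow> a * cs + u + 1) \<in> {1..b * cs}" using x by simp
  next
    fix i assume "i \<in> {1..b * cs}"
    then have "i - 1 < b * cs" by auto
    then show "((i - 1) div cs, (i - 1) mod cs) \<in> {..<b} \<times> {..<cs}"
      using False by (auto simp: less_mult_imp_div_less)
  qed (use False in auto)
  then show ?thesis by (simp add: sum.cartesian_product)
qed auto

lemma sum_PiE_prod_one:
  fixes w :: "'z \<Rightarrow> real" and b :: nat
  assumes "finite Z" "sum w Z = 1"
  shows "(\<Sum>\<omega>\<in>PiE {..<b} (\<lambda>_. Z). \<Prod>a<b. w (\<omega> a)) = 1"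
  using assms by (subst prod_sum_PiE[symmetric]) auto

lemma sum_PiE_prod_expectation:
  fixes w g :: "'z \<Rightarrow> real" and b :: nat
  assumes "finite Z" "sum w Z = 1" "c < b"
  shows "(\<Sum>\<omega>\<in>PiE {..<b} (\<lambda>_. Z). (\<Prod>a<b. w (\<omega> a)) * g (\<omega> c)) = (\<Sum>s\<in>Z. w s * g s)"
proof -
  have "(\<Sum>\<omega>\<in>PiE {..<b} (\<lambda>_. Z). (\<Prod>a<b. w (\<omega> a)) * g (\<omega> c))
      = (\<Sum>\<omega>\<in>PiE {..<b} (\<lambda>_. Z). \<Prod>a<b. w (\<omega> a) * (if a = c then g (\<omega> a) else 1))"
  proof -
    have "(\<Prod>a<b. if a = c then g (\<omega> a) else 1) = g (\<omega> c)" for \<omega>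
      using assms by (subst prod.delta) auto
    then show ?thesis by (simp add: prod.distrib)
  qed
  also have "\<dots> = (\<Prod>a<b. \<Sum>s\<in>Z. w s * (if a = c then g s else 1))"
    using assms by (subst prod_sum_PiE) auto
  also have "\<dots> = (\<Prod>a<b. if a = c then \<Sum>s\<in>Z. w s * g s else 1)"
    using assms by (intro prod.cong) auto
  finally show ?thesis using assms by simp
qed

text \<open>The likelihood splits into one factor per block, so that averaging over independent
  block states can be done block by block.\<close>

lemma prod_list_block_density:
  assumes "set xs \<subseteq> {1..b * cs}"
  shows "prod_list (map (block_density b cs \<mu> \<omega>) xs)
    = (1 / real b) ^ length xs *
      (\<Prod>a<b. prod_list (map (\<mu> (\<omega> a)) (map (\<lambda>i. (i - 1) mod cs) (filter (\<lambda>i. (i - 1) div cs = a) xs))))"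
  using assms
proof (induction xs)
  case (Cons x xs)
  let ?h = "\<lambda>a xs. prod_list (map (\<mu> (\<omega> a)) (map (\<lambda>i. (i - 1) mod cs) (filter (\<lambda>i. (i - 1) div cs = a) xs)))"
  let ?a = "(x - 1) div cs"
  have x: "?a < b" using Cons.prems by (intro less_mult_imp_div_less) auto
  have "(\<Prod>a<b. ?h a (x # xs)) = (\<Prod>a<b. (if a = ?a then \<mu> (\<omega> a) ((x - 1) mod cs) else 1) * ?h a xs)"
    by (intro prod.cong) auto
  also have "\<dots> = \<mu> (\<omega> ?a) ((x - 1) mod cs) * (\<Prod>a<b. ?h a xs)"
    using x by (simp add: prod.distrib prod.delta')
  finally show ?case using Cons by (simp add: block_density_def)
qed simp

lemma block_density_distr:
  assumes \<mu>: "\<And>s u. s \<in> Z \<Longrightarrow> u < cs \<Longrightarrow> \<mu> s u \<ge> 0" "\<And>s. s \<in> Z \<Longrightarrow> (\<Sum>u<cs. \<mu> s u) = 1"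
    and b: "b > 0" and \<omega>: "\<omega> \<in> PiE {..<b} (\<lambda>_. Z)"
  shows "\<And>i. i \<in> {1..b * cs} \<Longrightarrow> block_density b cs \<mu> \<omega> i \<ge> 0"
    and "sum (block_density b cs \<mu> \<omega>) {1..b * cs} = 1"
    and "c < b \<Longrightarrow> sum (block_density b cs \<mu> \<omega>) {i\<in>{1..b * cs}. (i - 1) div cs = c} = 1 / real b"
proof -
  have \<omega>Z: "\<omega> a \<in> Z" if "a < b" for a using \<omega> that by auto
  show "block_density b cs \<mu> \<omega> i \<ge> 0" if i: "i \<in> {1..b * cs}" for i
  proof -
    have "cs > 0" using i by (cases cs) auto
    moreover have "(i - 1) div cs < b" using i by (intro less_mult_imp_div_less) auto
    ultimately show ?thesis using \<mu>(1) \<omega>Z by (simp add: block_density_def)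
  qed
  have "sum (block_density b cs \<mu> \<omega>) {1..b * cs} = (\<Sum>a<b. \<Sum>u<cs. \<mu> (\<omega> a) u / real b)"
    unfolding block_density_def by (rule sum_over_blocks)
  also have "\<dots> = 1" using b \<omega>Z \<mu>(2) by (simp flip: sum_divide_distrib)
  finally show "sum (block_density b cs \<mu> \<omega>) {1..b * cs} = 1" .
  assume c: "c < b"
  have "sum (block_density b cs \<mu> \<omega>) {i\<in>{1..b * cs}. (i - 1) div cs = c}
      = (\<Sum>i\<in>{1..b * cs}. if (i - 1) div cs = c then block_density b cs \<mu> \<omega> i else 0)"
    by (rule sum.mono_neutral_cong_left) auto
  also have "\<dots> = (\<Sum>a<b. \<Sum>u<cs. if a = c then \<mu> (\<omega> a) u / real b else 0)"
    unfolding block_density_def by (rule sum_over_blocks)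
  also have "\<dots> = (\<Sum>a<b. if a = c then \<Sum>u<cs. \<mu> (\<omega> a) u / real b else 0)"
    by (intro sum.cong) auto
  also have "\<dots> = 1 / real b" using c \<omega>Z \<mu>(2) by (simp flip: sum_divide_distrib)
  finally show "sum (block_density b cs \<mu> \<omega>) {i\<in>{1..b * cs}. (i - 1) div cs = c} = 1 / real b" .
qed

text \<open>If no block receives more than \<open>D\<close> samples, the averaged likelihood is a
  product of block averages, and these agree by \<open>match\<close>. The other sample lists are
  handled by a union bound over the \<open>b\<close> blocks, and a tester gains at most their
  probability.\<close>

lemma blocks_indistinguishable:
  fixes y z :: "'z \<Rightarrow> real" and \<mu> :: "'z \<Rightarrow> nat \<Rightarrow> real"
  assumes Z: "finite Z"
    and y: "\<And>s. s \<in> Z \<Longrightarrow> y s \<ge> 0" "sum y Z = 1"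
    and z: "\<And>s. s \<in> Z \<Longrightarrow> z s \<ge> 0" "sum z Z = 1"
    and \<mu>: "\<And>s u. s \<in> Z \<Longrightarrow> u < cs \<Longrightarrow> \<mu> s u \<ge> 0" "\<And>s. s \<in> Z \<Longrightarrow> (\<Sum>u<cs. \<mu> s u) = 1"
    and match: "\<And>us. set us \<subseteq> {..<cs} \<Longrightarrow> length us \<le> D \<Longrightarrow>
      (\<Sum>s\<in>Z. y s * prod_list (map (\<mu> s) us)) = (\<Sum>s\<in>Z. z s * prod_list (map (\<mu> s) us))"
    and m: "m \<le> b" "b > 0" and T: "\<And>xs. 0 \<le> T xs \<and> T xs \<le> 1"
  shows "(\<Sum>\<omega>\<in>PiE {..<b} (\<lambda>_. Z). (\<Prod>a<b. y (\<omega> a)) * accept_prob (b * cs) m (block_density b cs \<mu> \<omega>) T)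
    \<le> (\<Sum>\<omega>\<in>PiE {..<b} (\<lambda>_. Z). (\<Prod>a<b. z (\<omega> a)) * accept_prob (b * cs) m (block_density b cs \<mu> \<omega>) T)
      + 3 * real b * (real m / real b) ^ Suc D"
proof -
  let ?n = "b * cs" and ?\<Omega> = "PiE {..<b} (\<lambda>_. Z)"
  let ?p = "block_density b cs \<mu>" and ?blk = "\<lambda>i. (i - 1) div cs"
  define X where "X = {xs :: nat list. length xs = m \<and> set xs \<subseteq> {1..?n}}"
  define bad where "bad = (\<Union>a<b. {xs\<in>X. Suc D \<le> length (filter (\<lambda>i. ?blk i = a) xs)})"
  define Q where "Q = (\<lambda>(w :: 'z \<Rightarrow> real) xs. \<Sum>\<omega>\<in>?\<Omega>. (\<Prod>a<b. w (\<omega> a)) * prod_list (map (?p \<omega>) xs))"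
  have finX: "finite X" unfolding X_def by (rule finite_sample_lists)
  have distr: "i \<in> {1..?n} \<Longrightarrow> ?p \<omega> i \<ge> 0" "sum (?p \<omega>) {1..?n} = 1"
    "a < b \<Longrightarrow> sum (?p \<omega>) {i\<in>{1..?n}. ?blk i = a} = 1 / real b" if "\<omega> \<in> ?\<Omega>" for \<omega> i a
    using block_density_distr[of Z cs \<mu> b \<omega>] \<mu> m(2) that by auto
  have accept: "(\<Sum>\<omega>\<in>?\<Omega>. (\<Prod>a<b. w (\<omega> a)) * accept_prob ?n m (?p \<omega>) T) = (\<Sum>xs\<in>X. Q w xs * T xs)" for w
    unfolding accept_prob_def Q_def X_def sum_distrib_left sum_distrib_right
    by (subst sum.swap) (simp add: mult.assoc)
  have nonneg: "Q w xs \<ge> 0" if w: "\<And>s. s \<in> Z \<Longrightarrow> w s \<ge> 0" and xs: "xs \<in> X" for w xs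
    unfolding Q_def using w xs distr(1)
    by (intro sum_nonneg mult_nonneg_nonneg prod_nonneg prod_list_nonneg_on) (auto simp: X_def PiE_def Pi_def)
  have Q_prod: "Q w xs = (1 / real b) ^ length xs * (\<Prod>a<b. \<Sum>s\<in>Z. w s *
      prod_list (map (\<mu> s) (map (\<lambda>i. (i - 1) mod cs) (filter (\<lambda>i. ?blk i = a) xs))))"
    if "xs \<in> X" for w xs
    using that Z
    by (subst prod_sum_PiE)
      (auto simp: Q_def X_def prod_list_block_density sum_distrib_left prod.distrib mult_ac intro!: sum.cong)
  have good: "Q y xs = Q z xs" if xs: "xs \<in> X - bad" for xs
  proof -
    have "(\<Sum>s\<in>Z. y s * prod_list (map (\<mu> s) (map (\<lambda>i. (i - 1) mod cs) (filter (\<lambda>i. ?blk i = a) xs))))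
        = (\<Sum>s\<in>Z. z s * prod_list (map (\<mu> s) (map (\<lambda>i. (i - 1) mod cs) (filter (\<lambda>i. ?blk i = a) xs))))"
      if a: "a < b" for a
    proof (rule match)
      show "length (map (\<lambda>i. (i - 1) mod cs) (filter (\<lambda>i. ?blk i = a) xs)) \<le> D"
        using xs a by (auto simp: bad_def not_less_eq_eq)
      have "cs > 0" if "x \<in> set xs" for x using xs that by (cases cs) (auto simp: X_def)
      then show "set (map (\<lambda>i. (i - 1) mod cs) (filter (\<lambda>i. ?blk i = a) xs)) \<subseteq> {..<cs}" by auto
    qed
    then show ?thesis using xs by (subst (1 2) Q_prod) auto
  qed
  have "sum (Q y) bad \<le> 3 * real b * (real m / real b) ^ Suc D"
  proof (cases "m = 0")
    case True
    then have "bad = {}" by (auto simp: bad_def X_def)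
    then show ?thesis by simp
  next
    case False
    have one: "(\<Sum>xs\<in>{xs\<in>X. Suc D \<le> length (filter (\<lambda>i. ?blk i = a) xs)}. Q y xs)
        \<le> 3 * (real m / real b) ^ Suc D" if a: "a < b" for a
    proof -
      let ?B = "{xs\<in>X. Suc D \<le> length (filter (\<lambda>i. ?blk i = a) xs)}"
      have "(\<Sum>xs\<in>?B. Q y xs) = (\<Sum>\<omega>\<in>?\<Omega>. (\<Prod>a<b. y (\<omega> a)) * (\<Sum>xs\<in>?B. prod_list (map (?p \<omega>) xs)))"
        unfolding Q_def sum_distrib_left by (rule sum.swap)
      also have "\<dots> \<le> (\<Sum>\<omega>\<in>?\<Omega>. (\<Prod>a<b. y (\<omega> a)) * (3 * (real m / real b) ^ Suc D))"
      proof (intro sum_mono mult_left_mono prod_nonneg)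
        fix \<omega> assume \<omega>: "\<omega> \<in> ?\<Omega>"
        show "y (\<omega> c) \<ge> 0" if "c \<in> {..<b}" for c using \<omega> y that by auto
        \<comment> \<open>This value balances the tail bound:
          \<open>(\<zeta> - 1) / b \<le> 1 / m\<close> keeps the numerator below
          \<open>exp 1\<close>, while the denominator gives the full power of
          \<open>m / b\<close>.\<close>
        define \<zeta> where "\<zeta> = real b / real m"
        have \<zeta>: "\<zeta> \<ge> 1" using False m by (simp add: \<zeta>_def)
        have "(\<Sum>xs\<in>?B. prod_list (map (?p \<omega>) xs)) \<le> (1 + (\<zeta> - 1) * (1 / real b)) ^ m / \<zeta> ^ Suc D"
          unfolding X_def mem_Collect_eq
          by (rule many_hits_bound[OF distr(1)[OF \<omega>] distr(2)[OF \<omega>] distr(3)[OF \<omega> a] \<zeta>])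
        also have "\<dots> \<le> (1 + 1 / real m) ^ m / \<zeta> ^ Suc D"
        proof (intro divide_right_mono power_mono)
          have "(\<zeta> - 1) * (1 / real b) = 1 / real m - 1 / real b"
            using False m by (simp add: \<zeta>_def field_simps)
          then show "1 + (\<zeta> - 1) * (1 / real b) \<le> 1 + 1 / real m" by simp
        qed (use \<zeta> in auto)
        also have "(1 + 1 / real m) ^ m \<le> 3"
        proof -
          have "(1 + 1 / real m) ^ m \<le> exp (1 / real m) ^ m"
            by (intro power_mono exp_ge_add_one_self) auto
          also have "\<dots> = exp 1" using False by (simp flip: exp_of_nat_mult)
          finally show ?thesis using exp_le by simp
        qed
        then have "(1 + 1 / real m) ^ m / \<zeta> ^ Suc D \<le> 3 / \<zeta> ^ Suc D"
          using \<zeta> by (intro divide_right_mono) auto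
        also have "3 / \<zeta> ^ Suc D = 3 * (real m / real b) ^ Suc D"
          by (simp add: \<zeta>_def power_divide)
        finally show "(\<Sum>xs\<in>?B. prod_list (map (?p \<omega>) xs)) \<le> 3 * (real m / real b) ^ Suc D" .
      qed
      also have "\<dots> = 3 * (real m / real b) ^ Suc D"
        unfolding sum_distrib_right[symmetric] using sum_PiE_prod_one[OF Z y(2), of b] by simp
      finally show ?thesis .
    qed
    have "sum (Q y) bad \<le> (\<Sum>a<b. \<Sum>xs\<in>{xs\<in>X. Suc D \<le> length (filter (\<lambda>i. ?blk i = a) xs)}. Q y xs)"
      unfolding bad_def using finX nonneg[of y] y by (intro sum_UN_le) auto
    also have "\<dots> \<le> (\<Sum>a<b. 3 * (real m / real b) ^ Suc D)" using one by (intro sum_mono) auto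
    finally show ?thesis by simp
  qed
  moreover have "(\<Sum>xs\<in>X. Q y xs * T xs) \<le> (\<Sum>xs\<in>X. Q z xs * T xs) + sum (Q y) bad"
  proof -
    have badX: "bad \<subseteq> X" by (auto simp: bad_def)
    have "(\<Sum>xs\<in>X. Q y xs * T xs) = (\<Sum>xs\<in>X - bad. Q y xs * T xs) + (\<Sum>xs\<in>bad. Q y xs * T xs)"
      using finX badX by (simp add: sum.subset_diff)
    also have "(\<Sum>xs\<in>X - bad. Q y xs * T xs) = (\<Sum>xs\<in>X - bad. Q z xs * T xs)"
      using good by simp
    also have "\<dots> \<le> (\<Sum>xs\<in>X. Q z xs * T xs)"
      using finX nonneg[of z] z T by (intro sum_mono2) auto
    also have "(\<Sum>xs\<in>bad. Q y xs * T xs) \<le> sum (Q y) bad"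
      using badX nonneg[of y] y T by (intro sum_mono mult_left_le) auto
    finally show ?thesis by simp
  qed
  ultimately show ?thesis unfolding accept by linarith
qed

section \<open>The random block\<close>

text \<open>The sets \<open>S\<close> correspond to the subsets of size \<open>N - card Y\<close> of
  \<open>A - Y\<close>. Falling factorials keep the formula polynomial in \<open>N\<close> and valid
  for \<open>card Y > N\<close>, where both sides vanish.\<close>

lemma supersets_of_fixed_size:
  assumes "finite A" "Y \<subseteq> A" "N \<le> card A"
  shows "real (card {S. S \<subseteq> A \<and> card S = N \<and> Y \<subseteq> S}) * (\<Prod>e<card Y. real (card A) - real e)
    = real (card A choose N) * (\<Prod>e<card Y. real N - real e)"
proof (cases "card Y \<le> N")
  case True
  have finY: "finite Y" using assms finite_subset by blast
  have falling: "(\<Prod>e<d. real n - real e) = fact d * real (n choose d)" for n d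
    by (simp add: binomial_gbinomial gbinomial_prod_rev atLeast0LessThan)
  have "bij_betw (\<lambda>S. S - Y) {S. S \<subseteq> A \<and> card S = N \<and> Y \<subseteq> S}
      {S. S \<subseteq> A - Y \<and> card S = N - card Y}"
  proof (rule bij_betw_byWitness[where f' = "\<lambda>S. S \<union> Y"])
    show "(\<lambda>S. S \<union> Y) ` {S. S \<subseteq> A - Y \<and> card S = N - card Y} \<subseteq> {S. S \<subseteq> A \<and> card S = N \<and> Y \<subseteq> S}"
    proof (clarsimp, intro conjI)
      fix S assume S: "S \<subseteq> A - Y" "card S = N - card Y"
      then have "finite S" "S \<inter> Y = {}" using assms finite_subset by blast+
      then show "card (S \<union> Y) = N" using S True finY by (simp add: card_Un_disjoint)
    qed (use assms in auto)
  qed (use assms finY in \<open>auto simp: card_Diff_subset\<close>)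
  then have "card {S. S \<subseteq> A \<and> card S = N \<and> Y \<subseteq> S} = (card A - card Y) choose (N - card Y)"
    using assms finY by (simp add: bij_betw_same_card n_subsets card_Diff_subset)
  then show ?thesis
    using choose_mult[OF True assms(3)] unfolding falling
    by (simp add: mult_ac flip: of_nat_mult)
next
  case False
  have "\<not> (Y \<subseteq> S \<and> card S = N \<and> S \<subseteq> A)" for S
    using False assms card_mono[of S Y] finite_subset by auto
  then have empty: "{S. S \<subseteq> A \<and> card S = N \<and> Y \<subseteq> S} = {}" by blast
  have "(\<Prod>e<card Y. real N - real e) = 0"
    using False by (intro prod_zero) auto
  then show ?thesis by (simp add: empty)
qed

text \<open>One block in units in which its total mass is \<open>10 Q\<close>: a first cell, \<open>I\<close> shadow cells,
  \<open>4 Q\<close> cells carrying equal atoms \<open>u\<close> on the set \<open>S\<close>, and a last cell. The parameter \<open>a\<close>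
  shifts the atoms by \<open>2 Q a\<close> to the right.\<close>

definition cell_mass :: "nat \<Rightarrow> nat \<Rightarrow> real \<Rightarrow> real \<Rightarrow> nat set \<Rightarrow> nat \<Rightarrow> real" where
  "cell_mass Q I a u S c =
     (if c = 0 then real Q * a
      else if c \<le> I then real Q * a / real I
      else if c \<le> I + 4 * Q then (if c - I - 1 \<in> S then u else 0)
      else 6 * real Q - 2 * real Q * a)"

lemma sum_shadow_cells:
  "x \<le> I \<Longrightarrow> (\<Sum>c<Suc x. cell_mass Q I a u S c) = real Q * a + real x * (real Q * a / real I)"
  by (induction x) (auto simp: cell_mass_def algebra_simps add_divide_distrib)

lemma sum_atom_cells:
  assumes "I > 0"
  shows "x \<le> 4 * Q \<Longrightarrow>
    (\<Sum>c<Suc I + x. cell_mass Q I a u S c) = 2 * real Q * a + u * real (card (S \<inter> {..<x}))"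
proof (induction x)
  case 0
  then show ?case using sum_shadow_cells[of I I Q a u S] assms by simp
next
  case (Suc x)
  have "S \<inter> {..<Suc x} = (if x \<in> S then insert x (S \<inter> {..<x}) else S \<inter> {..<x})"
    by (auto simp: less_Suc_eq)
  then have "real (card (S \<inter> {..<Suc x})) = real (card (S \<inter> {..<x})) + (if x \<in> S then 1 else 0)"
    by simp
  moreover have "cell_mass Q I a u S (Suc I + x) = (if x \<in> S then u else 0)"
    using Suc.prems by (auto simp: cell_mass_def)
  ultimately show ?case using Suc by (simp add: algebra_simps)
qed

lemma sum_cell_mass:
  assumes "I > 0" "S \<subseteq> {..<4 * Q}" "u * real (card S) = 4 * real Q"
  shows "(\<Sum>c<I + 4 * Q + 2. cell_mass Q I a u S c) = 10 * real Q"
proof -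
  have "S \<inter> {..<4 * Q} = S" using assms by auto
  moreover have "cell_mass Q I a u S (Suc I + 4 * Q) = 6 * real Q - 2 * real Q * a"
    by (simp add: cell_mass_def)
  moreover have "I + 4 * Q + 2 = Suc (Suc I + 4 * Q)" by simp
  ultimately show ?thesis
    using sum_atom_cells[OF assms(1), of "4 * Q" Q a u S] assms by (simp only: sum.lessThan_Suc)
qed

lemma cell_mass_nonneg:
  "0 \<le> a \<Longrightarrow> a \<le> 3 \<Longrightarrow> u \<ge> 0 \<Longrightarrow> cell_mass Q I a u S c \<ge> 0"
  using mult_left_mono[of a 3 "real Q"] by (auto simp: cell_mass_def mult.commute)

text \<open>Every sampled cell contributes either a factor affine in \<open>a\<close> or, inside the
  atom zone, a factor \<open>u\<close> together with the condition that the cell lies in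
  \<open>S\<close>. Here \<open>n\<close> counts the samples in the atom zone and \<open>Y\<close>
  collects the distinct cells they hit.\<close>

lemma prod_list_cell_mass:
  "set cs \<subseteq> {..<I + 4 * Q + 2} \<Longrightarrow>
   \<exists>f n Y. degree f \<le> length cs \<and> Y \<subseteq> {..<4 * Q} \<and> card Y \<le> n \<and> n \<le> length cs \<and>
     (\<forall>a u S. prod_list (map (cell_mass Q I a u S) cs) = poly f a * (if Y \<subseteq> S then u ^ n else 0))"
proof (induction cs)
  case Nil
  show ?case by (rule exI[of _ 1], rule exI[of _ 0], rule exI[of _ "{}"]) auto
next
  case (Cons c cs)
  then obtain f n Y where IH: "degree f \<le> length cs" "Y \<subseteq> {..<4 * Q}" "card Y \<le> n" "n \<le> length cs"
    "\<And>a u S. prod_list (map (cell_mass Q I a u S) cs) = poly f a * (if Y \<subseteq> S then u ^ n else 0)"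
    by (metis (no_types, lifting) insert_subset list.simps(15))
  have c: "c \<le> Suc (I + 4 * Q)" using Cons.prems by auto
  show ?case
  proof (cases "I < c \<and> c \<le> I + 4 * Q")
    case True
    have "card (insert (c - I - 1) Y) \<le> Suc n"
      using IH(3) finite_subset[OF IH(2)] by (simp add: card_insert_if)
    moreover have "cell_mass Q I a u S c = (if c - I - 1 \<in> S then u else 0)" for a u S
      using True by (auto simp: cell_mass_def)
    ultimately show ?thesis using True IH
      by (intro exI[of _ f] exI[of _ "Suc n"] exI[of _ "insert (c - I - 1) Y"]) auto
  next
    case False
    obtain \<alpha> \<beta> :: real where lin: "\<And>a u S. cell_mass Q I a u S c = \<alpha> + \<beta> * a"
    proof (cases "c = 0")
      case True
      show ?thesis by (rule that[of 0 "real Q"]) (use True in \<open>auto simp: cell_mass_def\<close>)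
    next
      case c0: False
      show ?thesis
      proof (cases "c \<le> I")
        case True
        show ?thesis
          by (rule that[of 0 "real Q / real I"]) (use c0 True in \<open>auto simp: cell_mass_def\<close>)
      next
        case cI: False
        show ?thesis by (rule that[of "6 * real Q" "- 2 * real Q"])
            (use c0 cI False in \<open>auto simp: cell_mass_def\<close>)
      qed
    qed
    have "degree ([:\<alpha>, \<beta>:] * f) \<le> Suc (length cs)"
      by (rule order.trans[OF degree_mult_le]) (use IH(1) in auto)
    then show ?thesis using IH
      by (intro exI[of _ "[:\<alpha>, \<beta>:] * f"] exI[of _ n] exI[of _ Y]) (auto simp: lin algebra_simps)
  qed
qed

text \<open>Averaged over the position of the atoms, the likelihood of a sample depends polynomially on
  \<open>a\<close> and on \<open>u\<close>: a fixed set of \<open>d\<close> cells is contained in the random set with probability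
  \<open>\<Prod>e<d. (N - e) / (4 Q - e)\<close>, and \<open>N u = 4 Q\<close>.\<close>

lemma mean_likelihood_poly:
  assumes "set cs \<subseteq> {..<I + 4 * Q + 2}" "length cs \<le> D"
  shows "\<exists>f g. degree f \<le> D \<and> degree g \<le> D \<and>
    (\<forall>a u N. real N * u = 4 * real Q \<longrightarrow> N \<le> 4 * Q \<longrightarrow>
      (\<Sum>S\<in>{S. S \<subseteq> {..<4 * Q} \<and> card S = N}. prod_list (map (cell_mass Q I a u S) cs))
        / real (4 * Q choose N) = poly f a * poly g u)"
proof -
  obtain f n Y where f: "degree f \<le> length cs" "Y \<subseteq> {..<4 * Q}" "card Y \<le> n" "n \<le> length cs"
    "\<And>a u S. prod_list (map (cell_mass Q I a u S) cs) = poly f a * (if Y \<subseteq> S then u ^ n else 0)"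
    using prod_list_cell_mass[OF assms(1)] by metis
  define d where "d = card Y"
  define P where "P = (\<Prod>e<d. 4 * real Q - real e)"
  \<comment> \<open>From \<open>N * u = 4 * Q\<close> follows
    \<open>(N - e) * u = 4 * Q - e * u\<close>, which removes \<open>N\<close> and leaves a
    polynomial in \<open>u\<close>. The factor of degree \<open>n - d\<close> accounts for repeated
    hits of the same atom, so the total degree is at most \<open>n\<close>.\<close>
  define g where "g = smult (1 / P) (monom 1 (n - d) * (\<Prod>e<d. [:4 * real Q, - real e:]))"
  have "d \<le> 4 * Q" using card_mono[OF _ f(2)] by (simp add: d_def)
  then have P: "P \<noteq> 0" by (auto simp: P_def)
  have "degree g \<le> D"
  proof -
    have "degree (\<Prod>e<d. [:4 * real Q, - real e:]) \<le> (\<Sum>e<d. degree [:4 * real Q, - real e:])"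
      by (rule degree_prod_sum_le[unfolded comp_def]) auto
    also have "\<dots> \<le> (\<Sum>e<d. 1)" by (rule sum_mono) auto
    finally have "degree (\<Prod>e<d. [:4 * real Q, - real e:]) \<le> d" by simp
    moreover have "degree (monom (1::real) (n - d)) \<le> n - d" by (rule degree_monom_le)
    ultimately have "degree (monom 1 (n - d) * (\<Prod>e<d. [:4 * real Q, - real e:])) \<le> (n - d) + d"
      by (intro order.trans[OF degree_mult_le] add_mono)
    then show ?thesis unfolding g_def
      using f assms(2) d_def by (intro order.trans[OF degree_smult_le]) auto
  qed
  moreover have "(\<Sum>S\<in>{S. S \<subseteq> {..<4 * Q} \<and> card S = N}. prod_list (map (cell_mass Q I a u S) cs))
        / real (4 * Q choose N) = poly f a * poly g u"
    if Nu: "real N * u = 4 * real Q" and N: "N \<le> 4 * Q" for a u N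
  proof -
    let ?F = "{S. S \<subseteq> {..<4 * Q} \<and> card S = N}"
    have fin: "finite ?F" by (rule finite_subset[of _ "Pow {..<4 * Q}"]) auto
    have choose: "real (4 * Q choose N) > 0" using N by simp
    have eq: "{S \<in> ?F. Y \<subseteq> S} = {S. S \<subseteq> {..<4 * Q} \<and> card S = N \<and> Y \<subseteq> S}" by blast
    have "(\<Sum>S\<in>?F. if Y \<subseteq> S then u ^ n else 0) = (\<Sum>S\<in>{S \<in> ?F. Y \<subseteq> S}. u ^ n)"
      using fin by (intro sum.mono_neutral_cong_right) auto
    also have "\<dots> = real (card {S. S \<subseteq> {..<4 * Q} \<and> card S = N \<and> Y \<subseteq> S}) * u ^ n"
      by (simp only: eq) simp
    also have "\<dots> * P = real (4 * Q choose N) * (\<Prod>e<d. real N - real e) * u ^ n"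
      using supersets_of_fixed_size[of "{..<4 * Q}" Y N] f(2) N
      by (simp add: P_def d_def mult_ac)
    also have "\<dots> = real (4 * Q choose N) * (u ^ (n - d) * (\<Prod>e<d. (real N - real e) * u))"
    proof -
      have "u ^ n = u ^ (n - d) * u ^ d" using f(3) by (simp add: d_def flip: power_add)
      then show ?thesis by (simp add: prod.distrib)
    qed
    also have "(\<Prod>e<d. (real N - real e) * u) = (\<Prod>e<d. 4 * real Q - real e * u)"
      using Nu by (simp add: left_diff_distrib)
    finally have "(\<Sum>S\<in>?F. if Y \<subseteq> S then u ^ n else 0) = real (4 * Q choose N) * poly g u"
      using P by (simp add: g_def poly_prod poly_monom field_simps)
    then show ?thesis using choose by (simp add: f(5) flip: sum_distrib_left)
  qed
  ultimately show ?thesis using f(1) assms(2) by (intro exI[of _ f] exI[of _ g]) auto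
qed

section \<open>The reference distribution\<close>

text \<open>The reference distribution is given by its cumulative sums, in units of \<open>1 / (10 Q b)\<close>:
  in every block of length \<open>10 Q\<close> they visit \<open>0\<close>, every integer in \<open>{3 Q..4 Q}\<close>, and \<open>10 Q\<close>.
  The index \<open>j\<close> carries the largest visited value not exceeding \<open>j\<close>, so many bins are empty.\<close>

definition ref_cumulative :: "nat \<Rightarrow> nat \<Rightarrow> nat \<Rightarrow> nat" where
  "ref_cumulative b Q j = (if j < b * (10 * Q)
     then 10 * Q * (j div (10 * Q)) + (if j mod (10 * Q) < 3 * Q then 0 else min (j mod (10 * Q)) (4 * Q))
     else b * (10 * Q))"

definition ref_distr :: "nat \<Rightarrow> nat \<Rightarrow> nat \<Rightarrow> real" where
  "ref_distr b Q j = (real (ref_cumulative b Q j) - real (ref_cumulative b Q (j - 1))) / real (b * (10 * Q))"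

lemma ref_cumulative_Suc:
  assumes "Q > 0"
  shows "ref_cumulative b Q j \<le> ref_cumulative b Q (Suc j)"
proof (cases "Suc j < b * (10 * Q)")
  case True
  show ?thesis
  proof (cases "Suc (j mod (10 * Q)) = 10 * Q")
    case True
    then have "Suc j div (10 * Q) = Suc (j div (10 * Q))" "Suc j mod (10 * Q) = 0"
      by (simp_all add: div_Suc mod_Suc)
    then show ?thesis using \<open>Suc j < b * (10 * Q)\<close> by (auto simp: ref_cumulative_def min_def)
  next
    case False
    then have "Suc j div (10 * Q) = j div (10 * Q)" "Suc j mod (10 * Q) = Suc (j mod (10 * Q))"
      by (simp_all add: div_Suc mod_Suc)
    then show ?thesis using \<open>Suc j < b * (10 * Q)\<close> by (auto simp: ref_cumulative_def min_def)
  qed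
next
  case False
  have "ref_cumulative b Q j \<le> b * (10 * Q)"
  proof (cases "j < b * (10 * Q)")
    case True
    have "ref_cumulative b Q j \<le> 10 * Q * (j div (10 * Q)) + 10 * Q"
      using True by (auto simp: ref_cumulative_def min_def)
    also have "\<dots> = Suc (j div (10 * Q)) * (10 * Q)" by simp
    also have "\<dots> \<le> b * (10 * Q)"
      using True by (intro mult_le_mono1) (simp add: Suc_le_eq less_mult_imp_div_less)
    finally show ?thesis .
  qed (simp add: ref_cumulative_def)
  then show ?thesis using False by (simp add: ref_cumulative_def)
qed

lemma ref_cumulative_mono: "Q > 0 \<Longrightarrow> i \<le> j \<Longrightarrow> ref_cumulative b Q i \<le> ref_cumulative b Q j"
  by (rule lift_Suc_mono_le[of "ref_cumulative b Q"]) (rule ref_cumulative_Suc)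

lemma ref_cumulative_0: "Q > 0 \<Longrightarrow> ref_cumulative b Q 0 = 0"
  by (simp add: ref_cumulative_def)

lemma ref_cumulative_end: "j \<ge> b * (10 * Q) \<Longrightarrow> ref_cumulative b Q j = b * (10 * Q)"
  by (simp add: ref_cumulative_def)

lemma ref_distr_is_distr:
  assumes "b > 0" "Q > 0" "k \<ge> b * (10 * Q)"
  shows "is_distr k (ref_distr b Q)"
proof -
  have "(\<Sum>j\<in>{1..k}. ref_distr b Q j)
      = (\<Sum>j<k. real (ref_cumulative b Q (Suc j)) / real (b * (10 * Q)) - real (ref_cumulative b Q j) / real (b * (10 * Q)))"
    by (rule sum.reindex_bij_witness[of _ Suc "\<lambda>j. j - 1"])
      (auto simp: ref_distr_def diff_divide_distrib)
  also have "\<dots> = real (ref_cumulative b Q k) / real (b * (10 * Q)) - real (ref_cumulative b Q 0) / real (b * (10 * Q))"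
    by (rule sum_lessThan_telescope)
  also have "\<dots> = 1" using assms by (simp add: ref_cumulative_0 ref_cumulative_end)
  finally have "(\<Sum>j\<in>{1..k}. ref_distr b Q j) = 1" .
  moreover have "ref_distr b Q j \<ge> 0" for j
    using ref_cumulative_mono[OF assms(2), of "j - 1" j b] by (simp add: ref_distr_def)
  ultimately show ?thesis by (simp add: is_distr_def)
qed

section \<open>Membership in and distance from the class of the reference distribution\<close>

lemma sum_consecutive_intervals:
  fixes f :: "nat \<Rightarrow> real"
  assumes "\<And>j. j < k \<Longrightarrow> v j \<le> v (Suc j)"
  shows "(\<Sum>j\<in>{1..k}. \<Sum>i\<in>{v (j - 1)<..v j}. f i) = (\<Sum>i\<in>{v 0<..v k}. f i) \<and> v 0 \<le> v k"
  using assms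
proof (induction k)
  case (Suc k)
  have "v 0 \<le> v k" "v k \<le> v (Suc k)" using Suc by auto
  then have "{v 0<..v (Suc k)} = {v 0<..v k} \<union> {v k<..v (Suc k)}" by auto
  then have "(\<Sum>i\<in>{v 0<..v (Suc k)}. f i) = (\<Sum>i\<in>{v 0<..v k}. f i) + (\<Sum>i\<in>{v k<..v (Suc k)}. f i)"
    by (simp only:) (intro sum.union_disjoint, auto)
  then show ?case using Suc le_trans[OF \<open>v 0 \<le> v k\<close> \<open>v k \<le> v (Suc k)\<close>] by simp
qed auto

text \<open>If the prefix sums of \<open>p\<close> attain every cumulative value of the reference
  distribution, cutting at these prefixes produces exactly its bin masses; repeated cumulative
  values give empty bins.\<close>

lemma mem_P_q_ref:
  assumes pos: "b > 0" "Q > 0" and k: "k \<ge> b * (10 * Q)" and p: "is_distr n p"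
    and hit: "\<And>j. j < b * (10 * Q) \<Longrightarrow>
      \<exists>x\<le>n. sum p {1..x} = real (ref_cumulative b Q j) / real (b * (10 * Q))"
  shows "p \<in> P_q n k (ref_distr b Q)"
proof -
  let ?T = "real (b * (10 * Q))"
  define F where "F = (\<lambda>x. sum p {1..x})"
  have F_mono: "F x \<le> F y" if "x \<le> y" "y \<le> n" for x y
    unfolding F_def using that p by (intro sum_mono2) (auto simp: is_distr_def)
  have Fn: "F n = 1" using p by (simp add: F_def is_distr_def)
  have hit': "\<exists>x\<le>n. F x = real (ref_cumulative b Q j) / ?T" for j
    using hit[of j] Fn pos
    by (cases "j < b * (10 * Q)") (auto simp: F_def ref_cumulative_end intro!: exI[of _ n])
  \<comment> \<open>Taking the least prefix makes the cut points monotone even when \<open>p\<close>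
    has zeros. The last cut is forced to \<open>n\<close>, since the least prefix of mass
    \<open>1\<close> may come earlier.\<close>
  define v where "v = (\<lambda>j. if j \<ge> k then n else LEAST x. F x \<ge> real (ref_cumulative b Q j) / ?T)"
  have v: "v j \<le> n \<and> F (v j) = real (ref_cumulative b Q j) / ?T" for j
  proof (cases "j \<ge> k")
    case True
    then show ?thesis using Fn k pos by (simp add: v_def ref_cumulative_end)
  next
    case False
    obtain x where x: "x \<le> n" "F x = real (ref_cumulative b Q j) / ?T" using hit' by blast
    have le: "v j \<le> x" using False x by (auto simp: v_def intro: Least_le)
    moreover have "F (v j) \<ge> real (ref_cumulative b Q j) / ?T"
      using False LeastI[of "\<lambda>x. F x \<ge> real (ref_cumulative b Q j) / ?T" x] x by (simp add: v_def)
    moreover have "F (v j) \<le> F x" using le x by (intro F_mono) auto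
    ultimately show ?thesis using x by simp
  qed
  have v_mono: "v j \<le> v (Suc j)" if "j < k" for j
  proof (cases "Suc j \<ge> k")
    case True
    then show ?thesis using v[of j] by (simp add: v_def)
  next
    case False
    have "real (ref_cumulative b Q j) / ?T \<le> F (v (Suc j))"
      using v[of "Suc j"] ref_cumulative_Suc[OF pos(2), of b j] by (simp add: divide_right_mono)
    then show ?thesis using that False by (auto simp: v_def intro: Least_le)
  qed
  have v0: "v 0 = 0"
  proof -
    have "k > 0" using k pos by (metis gr0I le_0_eq mult_is_0 neq0_conv zero_neq_numeral)
    then show ?thesis using pos
      by (auto simp: v_def ref_cumulative_0 F_def intro!: Least_equality)
  qed
  define J where "J = (\<lambda>j. if j \<in> {1..k} then {v (j - 1)<..v j} else {})"
  have "J \<in> interval_partitions n k"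
    unfolding interval_partitions_def using v0 v_mono
    by (auto simp: J_def intro!: exI[of _ v]) (simp_all add: v_def)
  moreover have "(\<Sum>i\<in>J j. p i) = ref_distr b Q j" if j: "j \<in> {1..k}" for j
  proof -
    have "Suc (j - 1) = j" "j - 1 < k" using j by auto
    then have le: "v (j - 1) \<le> v j" using v_mono[of "j - 1"] by simp
    then have "{1..v j} = {1..v (j - 1)} \<union> {v (j - 1)<..v j}" by auto
    then have "F (v j) = F (v (j - 1)) + (\<Sum>i\<in>{v (j - 1)<..v j}. p i)"
      unfolding F_def by (simp only:) (intro sum.union_disjoint, auto)
    then have "(\<Sum>i\<in>{v (j - 1)<..v j}. p i) = F (v j) - F (v (j - 1))" by simp
    then show ?thesis using j v[of j] v[of "j - 1"] by (simp add: J_def ref_distr_def diff_divide_distrib)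
  qed
  ultimately show ?thesis using p unfolding P_q_def by blast
qed

text \<open>Points carrying either nothing or at least twice the mass of a fine bin of the reference
  distribution cannot be used to fill these bins.\<close>

lemma far_from_P_q_ref:
  assumes pos: "b > 0" "Q > 0" and k: "k \<ge> b * (10 * Q)" and p: "is_distr n p"
    and p': "p' \<in> P_q n k (ref_distr b Q)"
    and G: "\<And>i. i \<in> {1..n} - E \<Longrightarrow> p i = 0 \<or> p i \<ge> 2 / real (b * (10 * Q))"
  shows "1 / 10 - sum p ({1..n} \<inter> E) \<le> (\<Sum>i\<in>{1..n}. \<bar>p i - p' i\<bar>)"
proof -
  let ?T = "real (b * (10 * Q))"
  obtain v where v: "v 0 = 0" "v k = n" "\<And>j. j < k \<Longrightarrow> v j \<le> v (Suc j)"
    and q: "\<And>j. j \<in> {1..k} \<Longrightarrow> (\<Sum>i\<in>{v (j - 1)<..v j}. p' i) = ref_distr b Q j"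
    and p'd: "is_distr n p'"
  proof -
    obtain J v where "v 0 = 0" "v k = n" "\<forall>j<k. v j \<le> v (Suc j)"
      "\<forall>j\<in>{1..k}. J j = {v (j - 1)<..v j}" "\<forall>j\<in>{1..k}. sum p' (J j) = ref_distr b Q j" "is_distr n p'"
      using p' unfolding P_q_def interval_partitions_def by blast
    then show ?thesis by (intro that[of v]) auto
  qed
  have v_le: "v i \<le> v j" if "i \<le> j" "j \<le> k" for i j
    using that v(3) by (induction j) (auto simp: le_Suc_eq intro: order.trans)
  \<comment> \<open>There are \<open>Q\<close> unit bins in each of the \<open>b\<close> blocks, so
    the fine bins carry a tenth of the total mass.\<close>
  define fine where "fine = (\<lambda>(a, u). a * (10 * Q) + u) ` ({..<b} \<times> {3 * Q<..4 * Q})"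
  have card_fine: "card fine = b * Q"
  proof -
    have "inj_on (\<lambda>(a, u). a * (10 * Q) + u) ({..<b} \<times> {3 * Q<..4 * Q})"
    proof (rule inj_onI, clarify)
      fix a u a' u' assume u: "u \<in> {3 * Q<..4 * Q}" "u' \<in> {3 * Q<..4 * Q}"
        and eq: "a * (10 * Q) + u = a' * (10 * Q) + u'"
      have "u < 10 * Q" "u' < 10 * Q" using u pos by auto
      then have "(a * (10 * Q) + u) mod (10 * Q) = u" "(a' * (10 * Q) + u') mod (10 * Q) = u'" by simp_all
      then have "u = u'" using eq by simp
      then show "a = a' \<and> u = u'" using eq pos by simp
    qed
    then show ?thesis by (simp add: fine_def card_image)
  qed
  have fine: "j \<in> {1..k} \<and> ref_distr b Q j = 1 / ?T" if "j \<in> fine" for j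
  proof -
    obtain a u where j: "j = a * (10 * Q) + u" "a < b" "3 * Q < u" "u \<le> 4 * Q"
      using \<open>j \<in> fine\<close> by (auto simp: fine_def)
    have ju: "j - 1 = a * (10 * Q) + (u - 1)" using j by simp
    have "u < 10 * Q" using j pos by simp
    have "j < a * (10 * Q) + 10 * Q" using j pos by simp
    also have "\<dots> = Suc a * (10 * Q)" by simp
    also have "\<dots> \<le> b * (10 * Q)" using j by (intro mult_le_mono1) auto
    finally have jT: "j < b * (10 * Q)" .
    have "j mod (10 * Q) = u" "j div (10 * Q) = a" using \<open>u < 10 * Q\<close> j(1) pos by simp_all
    moreover have "(j - 1) mod (10 * Q) = u - 1" "(j - 1) div (10 * Q) = a"
      using \<open>u < 10 * Q\<close> ju pos by simp_all
    moreover have "\<not> u < 3 * Q" "\<not> u - 1 < 3 * Q" "j - 1 < b * (10 * Q)" "min u (4 * Q) = u"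
      "min (u - 1) (4 * Q) = u - 1" "u \<ge> 1"
      using j jT by auto
    ultimately have "ref_cumulative b Q j = 10 * Q * a + u" "ref_cumulative b Q (j - 1) = 10 * Q * a + (u - 1)"
      using jT by (simp_all add: ref_cumulative_def)
    then have "real (ref_cumulative b Q j) - real (ref_cumulative b Q (j - 1)) = 1"
      using \<open>u \<ge> 1\<close> by simp
    then show ?thesis using j jT k by (simp add: ref_distr_def)
  qed
  let ?e = "\<lambda>i. if i \<in> E then p i else 0"
  have p_nn: "p i \<ge> 0" "p' i \<ge> 0" if "i \<in> {1..n}" for i using that p p'd by (auto simp: is_distr_def)
  have "(if j \<in> fine then 1 / ?T else 0) - (\<Sum>i\<in>{v (j - 1)<..v j}. ?e i)
      \<le> (\<Sum>i\<in>{v (j - 1)<..v j}. \<bar>p i - p' i\<bar>)" if j: "j \<in> {1..k}" for j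
  proof -
    have sub: "{v (j - 1)<..v j} \<subseteq> {1..n}" using v_le[of j k] v(2) j by auto
    show ?thesis
    proof (cases "j \<in> fine")
      case True
      have sum: "(\<Sum>i\<in>{v (j - 1)<..v j}. p' i) = 1 / ?T" using q[OF j] fine[OF True] by simp
      \<comment> \<open>In a fine bin \<open>p' i \<le> 1 / ?T\<close>. Outside \<open>E\<close>
        either \<open>p i = 0\<close>, or \<open>p i\<close> exceeds \<open>p' i\<close> by at least
        \<open>1 / ?T\<close>; in both cases the difference is at least \<open>p' i\<close>. On
        \<open>E\<close> the mass of \<open>p\<close> is given away.\<close>
      have "p' i - ?e i \<le> \<bar>p i - p' i\<bar>" if i: "i \<in> {v (j - 1)<..v j}" for i
      proof (cases "i \<in> E")
        case False
        have "p' i \<le> (\<Sum>i\<in>{v (j - 1)<..v j}. p' i)"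
          using i sub p_nn(2) by (intro member_le_sum) auto
        then have "p' i \<le> 1 / ?T" using sum by simp
        moreover have "p i = 0 \<or> p i \<ge> 2 * (1 / ?T)" using G[of i] False i sub by auto
        ultimately show ?thesis using False i sub p_nn(2)[of i] by (auto simp del: of_nat_mult)
      qed auto
      then have "(\<Sum>i\<in>{v (j - 1)<..v j}. p' i - ?e i) \<le> (\<Sum>i\<in>{v (j - 1)<..v j}. \<bar>p i - p' i\<bar>)"
        by (rule sum_mono)
      then show ?thesis using True sum by (simp add: sum_subtractf)
    next
      case False
      have "0 \<le> (\<Sum>i\<in>{v (j - 1)<..v j}. ?e i)" "0 \<le> (\<Sum>i\<in>{v (j - 1)<..v j}. \<bar>p i - p' i\<bar>)"
        using sub p_nn(1) by (intro sum_nonneg; auto)+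
      then show ?thesis using False by (simp only: if_False)
    qed
  qed
  then have "(\<Sum>j\<in>{1..k}. (if j \<in> fine then 1 / ?T else 0) - (\<Sum>i\<in>{v (j - 1)<..v j}. ?e i))
      \<le> (\<Sum>j\<in>{1..k}. \<Sum>i\<in>{v (j - 1)<..v j}. \<bar>p i - p' i\<bar>)"
    by (rule sum_mono)
  moreover have "(\<Sum>j\<in>{1..k}. if j \<in> fine then 1 / ?T else 0) = 1 / 10"
  proof -
    have "(\<Sum>j\<in>{1..k}. if j \<in> fine then 1 / ?T else 0) = (\<Sum>j\<in>fine. 1 / ?T)"
      using fine by (intro sum.mono_neutral_cong_right) auto
    also have "\<dots> = 1 / 10" using pos by (simp add: card_fine)
    finally show ?thesis .
  qed
  moreover have cons: "(\<Sum>j\<in>{1..k}. \<Sum>i\<in>{v (j - 1)<..v j}. f i) = (\<Sum>i\<in>{1..n}. f i)" for f :: "nat \<Rightarrow> real"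
  proof -
    have "{v 0<..v k} = {1..n}" using v by auto
    then show ?thesis using sum_consecutive_intervals[of k v f] v(3) by simp
  qed
  moreover have "(\<Sum>i\<in>{1..n}. ?e i) = sum p ({1..n} \<inter> E)"
    by (simp add: sum.inter_restrict)
  ultimately show ?thesis by (simp add: sum_subtractf)
qed

text \<open>Nonemptiness of the class is what makes a pointwise lower bound pass to the
  infimum.\<close>

lemma dTV_P_q_ref:
  assumes "b > 0" "Q > 0" "k \<ge> b * (10 * Q)" "is_distr n p" "P_q n k (ref_distr b Q) \<noteq> {}"
    "\<And>i. i \<in> {1..n} - E \<Longrightarrow> p i = 0 \<or> p i \<ge> 2 / real (b * (10 * Q))"
  shows "1 / 20 - sum p ({1..n} \<inter> E) / 2 \<le> dTV_set n p (P_q n k (ref_distr b Q))"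
  unfolding dTV_set_def
proof (rule cINF_greatest)
  fix p' assume "p' \<in> P_q n k (ref_distr b Q)"
  from far_from_P_q_ref[OF assms(1-4) this assms(6)]
  show "1 / 20 - sum p ({1..n} \<inter> E) / 2 \<le> 1 / 2 * (\<Sum>i\<in>{1..n}. \<bar>p i - p' i\<bar>)" by simp
qed (rule assms)

section \<open>Matching mixtures of block states\<close>

text \<open>Index \<open>0\<close> stands for the unshifted block, and the indices from
  \<open>1\<close> to \<open>D + 1\<close> for the nodes of
  \<open>extrapolate_to_zero\<close>.\<close>

definition shift_node :: "nat \<Rightarrow> nat \<Rightarrow> real" where
  "shift_node D e = (if e = 0 then 0 else 2 + real (e - 1) / real D)"

text \<open>Up to a normalisation, \<open>Y\<close> and \<open>N\<close> are the positive and negative parts of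
  \<open>\<delta>(0, 0) - \<delta>(0, 1) - (\<Sum>e>0. \<Sum>j. L (e - 1) * K j * \<delta>(e, j))\<close>: the small correction terms that turn \<open>(0, 1)\<close>
  into \<open>(0, 0)\<close> are moved by extrapolation from the shift \<open>0\<close> to the shifts in \<open>{2..3}\<close>.\<close>

lemma matching_weights:
  assumes D: "D > 0" and J: "J = \<gamma> + D + 1"
  obtains Y N :: "nat \<Rightarrow> nat \<Rightarrow> real" where "\<And>e j. 0 \<le> Y e j" "\<And>e j. 0 \<le> N e j"
    "\<And>j. Y 0 j \<noteq> 0 \<Longrightarrow> j = 0"
    "(\<Sum>e\<le>D + 1. \<Sum>j\<le>J. Y e j) = 1" "(\<Sum>e\<le>D + 1. \<Sum>j\<le>J. N e j) = 1"
    "1 - 2 * 24 ^ D / 4 ^ \<gamma> \<le> N 0 1"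
    "\<And>f g :: real poly. degree f \<le> D \<Longrightarrow> degree g \<le> D \<Longrightarrow>
       (\<Sum>e\<le>D + 1. \<Sum>j\<le>J. Y e j * (poly f (shift_node D e) * poly g (16 ^ j))) =
       (\<Sum>e\<le>D + 1. \<Sum>j\<le>J. N e j * (poly f (shift_node D e) * poly g (16 ^ j)))"
proof -
  obtain K :: "nat \<Rightarrow> real" where K: "(\<Sum>j\<le>J. \<bar>K j\<bar>) \<le> 2 / 4 ^ \<gamma>"
    "\<And>g::real poly. degree g \<le> D \<Longrightarrow> poly g 1 - poly g 16 = (\<Sum>j\<le>J. K j * poly g (16 ^ j))"
    using geometric_near_equivalence[of \<gamma> D] J by auto
  obtain L :: "nat \<Rightarrow> real" where L: "(\<Sum>l\<le>D. \<bar>L l\<bar>) \<le> 24 ^ D"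
    "\<And>f::real poly. degree f \<le> D \<Longrightarrow> poly f 0 = (\<Sum>l\<le>D. L l * poly f (2 + real l / real D))"
    using extrapolate_to_zero[OF D] by blast
  define M where "M = (\<lambda>e j. if e = 0 then 0 else L (e - 1) * K j)"
  \<comment> \<open>\<open>M\<close> vanishes for \<open>e = 0\<close>, so the only unshifted state
    of \<open>Y0\<close> is \<open>(0, 0)\<close> and the only one of \<open>N0\<close> is
    \<open>(0, 1)\<close>.\<close>
  define Y0 where "Y0 = (\<lambda>e j::nat. (if e = 0 \<and> j = 0 then 1 else 0) + max 0 (- M e j))"
  define N0 where "N0 = (\<lambda>e j::nat. (if e = 0 \<and> j = 1 then 1 else 0) + max 0 (M e j))"
  have J1: "1 \<le> J" using J by simp
  have point: "(\<Sum>e\<le>D + 1. \<Sum>j\<le>J. (if e = 0 \<and> j = j0 then 1 else 0) * h e j) = h 0 j0"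
    if "j0 \<le> J" for j0 and h :: "nat \<Rightarrow> nat \<Rightarrow> real"
  proof -
    have "(\<Sum>e\<le>D + 1. \<Sum>j\<le>J. (if e = 0 \<and> j = j0 then 1 else 0) * h e j)
        = (\<Sum>e\<le>D + 1. if e = 0 then \<Sum>j\<le>J. if j = j0 then h 0 j else 0 else 0)"
      by (intro sum.cong) (simp_all add: if_distrib[of "\<lambda>x. x * _"] cong: if_cong)
    then show ?thesis using that by simp
  qed
  have M_sum: "(\<Sum>e\<le>D + 1. \<Sum>j\<le>J. M e j * (x e * z j)) = (\<Sum>l\<le>D. L l * x (Suc l)) * (\<Sum>j\<le>J. K j * z j)"
    for x z :: "nat \<Rightarrow> real"
  proof -
    have "(\<Sum>e\<le>Suc D. \<Sum>j\<le>J. M e j * (x e * z j)) = (\<Sum>l\<le>D. \<Sum>j\<le>J. L l * x (Suc l) * (K j * z j))"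
      by (simp only: sum.atMost_Suc_shift) (simp add: M_def mult_ac)
    then show ?thesis by (simp add: sum_product)
  qed
  have diff: "Y0 e j - N0 e j = (if e = 0 \<and> j = 0 then 1 else 0) - (if e = 0 \<and> j = 1 then 1 else 0) - M e j" for e j
    by (simp add: Y0_def N0_def max_def)
  have eq: "(\<Sum>e\<le>D + 1. \<Sum>j\<le>J. Y0 e j * (poly f (shift_node D e) * poly g (16 ^ j))) =
       (\<Sum>e\<le>D + 1. \<Sum>j\<le>J. N0 e j * (poly f (shift_node D e) * poly g (16 ^ j)))"
    if "degree f \<le> D" "degree g \<le> D" for f g :: "real poly"
  proof -
    let ?h = "\<lambda>e j. poly f (shift_node D e) * poly g (16 ^ j)"
    have "(\<Sum>e\<le>D + 1. \<Sum>j\<le>J. Y0 e j * ?h e j) - (\<Sum>e\<le>D + 1. \<Sum>j\<le>J. N0 e j * ?h e j)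
        = (\<Sum>e\<le>D + 1. \<Sum>j\<le>J. (Y0 e j - N0 e j) * ?h e j)"
      by (simp only: left_diff_distrib sum_subtractf)
    also have "\<dots> = (\<Sum>e\<le>D + 1. \<Sum>j\<le>J. (if e = 0 \<and> j = 0 then 1 else 0) * ?h e j)
        - (\<Sum>e\<le>D + 1. \<Sum>j\<le>J. (if e = 0 \<and> j = 1 then 1 else 0) * ?h e j)
        - (\<Sum>e\<le>D + 1. \<Sum>j\<le>J. M e j * ?h e j)"
      by (simp only: diff left_diff_distrib sum_subtractf)
    also have "\<dots> = ?h 0 0 - ?h 0 1 - (\<Sum>l\<le>D. L l * poly f (shift_node D (Suc l))) * (\<Sum>j\<le>J. K j * poly g (16 ^ j))"
      using point[of 0 ?h] point[OF J1, of ?h] M_sum[of "\<lambda>e. poly f (shift_node D e)" "\<lambda>j. poly g (16 ^ j)"]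
      by simp
    also have "\<dots> = 0"
      using K(2)[OF that(2)] L(2)[OF that(1)] by (simp add: shift_node_def algebra_simps)
    finally show ?thesis by simp
  qed
  define t where "t = (\<Sum>e\<le>D + 1. \<Sum>j\<le>J. N0 e j)"
  \<comment> \<open>The matching identity for constant polynomials shows that both parts have the
    same total, so one normalisation serves both and preserves the identity.\<close>
  have tY: "(\<Sum>e\<le>D + 1. \<Sum>j\<le>J. Y0 e j) = t"
    using eq[of 1 1] by (simp add: t_def del: sum.atMost_Suc)
  have t_eq: "t = 1 + (\<Sum>e\<le>D + 1. \<Sum>j\<le>J. max 0 (M e j))"
    using point[OF J1, of "\<lambda>_ _. 1"] by (simp only: t_def N0_def sum.distrib mult_1_right)
  have "0 \<le> (\<Sum>e\<le>D + 1. \<Sum>j\<le>J. max 0 (M e j))" by (intro sum_nonneg) auto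
  then have t1: "t \<ge> 1" using t_eq by simp
  define \<theta> :: real where "\<theta> = 2 * 24 ^ D / 4 ^ \<gamma>"
  have "(\<Sum>e\<le>D + 1. \<Sum>j\<le>J. max 0 (M e j)) \<le> (\<Sum>l\<le>D. \<bar>L l\<bar>) * (\<Sum>j\<le>J. \<bar>K j\<bar>)"
  proof -
    have "(\<Sum>e\<le>Suc D. \<Sum>j\<le>J. max 0 (M e j)) = (\<Sum>l\<le>D. \<Sum>j\<le>J. max 0 (L l * K j))"
      by (simp only: sum.atMost_Suc_shift) (simp add: M_def)
    also have "\<dots> \<le> (\<Sum>l\<le>D. \<Sum>j\<le>J. \<bar>L l\<bar> * \<bar>K j\<bar>)"
      by (intro sum_mono) (simp flip: abs_mult)
    finally show ?thesis by (simp add: sum_product)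
  qed
  also have "\<dots> \<le> 24 ^ D * (2 / 4 ^ \<gamma>)" by (intro mult_mono K L sum_nonneg) auto
  finally have t_le: "t \<le> 1 + \<theta>" using t_eq by (simp add: \<theta>_def mult.commute)
  have "1 - \<theta> \<le> 1 / t"
  proof (cases "\<theta> \<le> 1")
    case True
    have "(1 - \<theta>) * t \<le> (1 - \<theta>) * (1 + \<theta>)" using True t_le by (intro mult_left_mono) auto
    also have "\<dots> \<le> 1" by (simp add: algebra_simps)
    finally show ?thesis using t1 by (simp add: field_simps)
  next
    case False
    then show ?thesis using t1 by (simp add: order.trans[of _ 0])
  qed
  moreover have "N0 0 1 = 1" by (simp add: N0_def M_def)
  moreover have "Y0 0 j = 0" if "j \<noteq> 0" for j using that by (simp add: Y0_def M_def)
  moreover have "0 \<le> Y0 e j" "0 \<le> N0 e j" for e j by (simp_all add: Y0_def N0_def)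
  moreover have "(\<Sum>e\<le>D + 1. \<Sum>j\<le>J. Y0 e j / t) = 1" "(\<Sum>e\<le>D + 1. \<Sum>j\<le>J. N0 e j / t) = 1"
    unfolding sum_divide_distrib[symmetric] tY t_def[symmetric] using t1 by auto
  moreover have "(\<Sum>e\<le>D + 1. \<Sum>j\<le>J. Y0 e j / t * h e j) = (\<Sum>e\<le>D + 1. \<Sum>j\<le>J. N0 e j / t * h e j)"
    if "(\<Sum>e\<le>D + 1. \<Sum>j\<le>J. Y0 e j * h e j) = (\<Sum>e\<le>D + 1. \<Sum>j\<le>J. N0 e j * h e j)" for h
    using that by (simp only: times_divide_eq_left sum_divide_distrib[symmetric])
  ultimately show ?thesis
    using t1 eq by (intro that[of "\<lambda>e j. Y0 e j / t" "\<lambda>e j. N0 e j / t"]) (auto simp: \<theta>_def simp del: sum.atMost_Suc)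
qed

lemma sum_prefix_block_density:
  assumes "a < b" "x \<le> cs" "cs > 0" "\<And>c. c < a \<Longrightarrow> (\<Sum>u<cs. \<mu> (\<omega> c) u) = 1"
  shows "sum (block_density b cs \<mu> \<omega>) {1..a * cs + x} = (real a + (\<Sum>u<x. \<mu> (\<omega> a) u)) / real b"
proof -
  have split: "{1..a * cs + x} = {1..a * cs} \<union> {a * cs + 1..a * cs + x}" by auto
  have "sum (block_density b cs \<mu> \<omega>) {1..a * cs + x}
      = sum (block_density b cs \<mu> \<omega>) {1..a * cs} + sum (block_density b cs \<mu> \<omega>) {a * cs + 1..a * cs + x}"
    unfolding split by (rule sum.union_disjoint) auto
  also have "sum (block_density b cs \<mu> \<omega>) {1..a * cs} = (\<Sum>c<a. \<Sum>u<cs. \<mu> (\<omega> c) u / real b)"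
    unfolding block_density_def by (rule sum_over_blocks)
  also have "\<dots> = real a / real b" using assms by (simp flip: sum_divide_distrib)
  also have "sum (block_density b cs \<mu> \<omega>) {a * cs + 1..a * cs + x}
      = (\<Sum>u<x. block_density b cs \<mu> \<omega> (a * cs + u + 1))"
    by (rule sum.reindex_bij_witness[of _ "\<lambda>u. a * cs + u + 1" "\<lambda>i. i - (a * cs + 1)"]) auto
  also have "\<dots> = (\<Sum>u<x. \<mu> (\<omega> a) u / real b)"
    using assms(2,3) by (intro sum.cong) (auto simp: block_density_def)
  finally show ?thesis by (simp add: add_divide_distrib sum_divide_distrib)
qed

text \<open>In a shifted block the shadow cells cover the zone from \<open>3 Q\<close> to \<open>4 Q\<close>, and the choice of \<open>I\<close> lets
  their boundaries hit every integer of this zone for all \<open>D + 1\<close> shifts.\<close>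

lemma shifted_block_visits:
  assumes D: "D > 0" and Q: "Q > 0" and I: "I = Q * fact (3 * D)" and S: "S \<subseteq> {..<4 * Q}"
    and e: "e \<le> D + 1" and e0: "e = 0 \<Longrightarrow> u = 1 \<and> S = {..<4 * Q}"
  shows "\<exists>x\<le>I + 4 * Q + 2. (\<Sum>c<x. cell_mass Q I (shift_node D e) u S c)
    = real (if r < 3 * Q then 0 else min r (4 * Q))"
proof (cases "r < 3 * Q")
  case True
  then show ?thesis by (intro exI[of _ 0]) auto
next
  case False
  define m where "m = min r (4 * Q)"
  have m: "3 * Q \<le> m" "m \<le> 4 * Q" using False by (auto simp: m_def)
  have I0: "I > 0" using Q I by simp
  have "\<exists>x\<le>I + 4 * Q + 2. (\<Sum>c<x. cell_mass Q I (shift_node D e) u S c) = real m"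
  proof (cases "e = 0")
    case True
    \<comment> \<open>Without shift the shadow cells are empty and the unit atoms fill the whole
      zone, so the prefix sums grow in unit steps.\<close>
    have "S \<inter> {..<m} = {..<m}" using e0[OF True] m by auto
    then show ?thesis using sum_atom_cells[OF I0 m(2), of 0 u S] e0[OF True] True m
      by (intro exI[of _ "Suc I + m"]) (auto simp: shift_node_def)
  next
    case False
    define l where "l = e - 1"
    \<comment> \<open>For the shift \<open>(2 * D + l) / D\<close> a shadow cell has mass
      \<open>1 / (D * t)\<close>, and \<open>t\<close> is an integer because
      \<open>2 * D + l \<le> 3 * D\<close>. The first cell has the mass of \<open>I\<close> such
      cells, so \<open>m\<close> is reached after \<open>m * D * t - I\<close> shadow cells. The
      bounds \<open>lo\<close> and \<open>hi\<close> say that \<open>m\<close> lies between the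
      start and the end of the shadow zone.\<close>
    define t where "t = fact (3 * D) div (2 * D + l)"
    have l: "l \<le> D" using e by (simp add: l_def)
    have "(2 * D + l) dvd fact (3 * D)" using D l by (intro dvd_fact) auto
    then have t: "t * (2 * D + l) = fact (3 * D)" by (simp add: t_def)
    have It: "I = Q * (t * (2 * D + l))" using I t by simp
    have lo: "I \<le> m * D * t"
    proof -
      have "I \<le> Q * (t * (3 * D))" unfolding It using l by (intro mult_le_mono2) auto
      also have "\<dots> = 3 * Q * (D * t)" by simp
      also have "\<dots> \<le> m * (D * t)" using m by (intro mult_le_mono1)
      finally show ?thesis by (simp add: mult.assoc)
    qed
    have hi: "m * D * t \<le> 2 * I"
    proof -
      have "m * (D * t) \<le> 4 * Q * (D * t)" using m by (intro mult_le_mono1)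
      also have "\<dots> = 2 * (Q * (t * (2 * D)))" by simp
      also have "\<dots> \<le> 2 * I" unfolding It by (intro mult_le_mono2) auto
      finally show ?thesis by (simp add: mult.assoc)
    qed
    define a where "a = shift_node D e"
    have a: "a * real D = real (2 * D + l)" using D False by (simp add: a_def shift_node_def l_def field_simps)
    have "real (m * D * t - I) * (real Q * a / real I) = real m * (real (D * t) * real Q * a / real I) - real Q * a"
      using lo I0 by (simp add: of_nat_diff field_simps)
    also have "real (D * t) * real Q * a = real I"
    proof -
      have "real (D * t) * real Q * a = real t * real Q * (a * real D)" by simp
      then show ?thesis by (simp only: a It of_nat_mult) simp
    qed
    finally have "real Q * a + real (m * D * t - I) * (real Q * a / real I) = real m" using I0 by simp
    moreover have "m * D * t - I \<le> I" using hi by simp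
    ultimately show ?thesis using sum_shadow_cells[of "m * D * t - I" I Q a u S]
      by (intro exI[of _ "Suc (m * D * t - I)"]) (auto simp: a_def)
  qed
  then show ?thesis using False by (simp add: m_def)
qed

lemma accept_prob_le_1:
  assumes "is_distr n p" "\<And>xs. 0 \<le> T xs \<and> T xs \<le> 1"
  shows "accept_prob n m p T \<le> 1"
proof -
  have "accept_prob n m p T \<le> (\<Sum>xs\<in>{xs. length xs = m \<and> set xs \<subseteq> {1..n}}. prod_list (map p xs))"
    unfolding accept_prob_def using assms
    by (intro sum_mono mult_left_le prod_list_nonneg_on) (auto simp: is_distr_def)
  also have "\<dots> = 1" using assms by (simp add: sum_lists_prod_list is_distr_def)
  finally show ?thesis .
qed

section \<open>The lower bound\<close>

lemma prod_list_map_divide: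
  "prod_list (map (\<lambda>x. f x / d) xs) = prod_list (map f xs) / (d :: real) ^ length xs"
  by (induction xs) auto

text \<open>Two priors that draw the block states independently from \<open>Y\<close> or
  \<open>N\<close> are compared. The tester must accept with mean probability at least
  \<open>2 / 3\<close> under \<open>Y\<close> and at most \<open>1 / 3 + 1 / 6\<close> under
  \<open>N\<close>, but these differ by less than \<open>1 / 10\<close>.\<close>

lemma no_tester:
  fixes D \<gamma> b Q I k n m :: nat
  assumes D: "D > 0" and Q: "Q = 4 * 16 ^ (\<gamma> + D)" and I: "I = Q * fact (3 * D)"
    and b: "b > 0" and k: "k \<ge> b * (10 * Q)" and n: "n = b * (I + 4 * Q + 2)"
    and \<theta>: "2 * 24 ^ D / 4 ^ \<gamma> \<le> (1 / 100 :: real)"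
    and m: "m \<le> b" "3 * real b * (real m / real b) ^ Suc D < 1 / 10"
  shows "\<not> solves_BinIdentity n (ref_distr b Q) k (1 / 50) m T"
proof
  assume solves: "solves_BinIdentity n (ref_distr b Q) k (1 / 50) m T"
  define J where "J = \<gamma> + D + 1"
  \<comment> \<open>With this \<open>Q\<close>, for every \<open>j \<le> J\<close> exactly
    \<open>16 ^ (J - j)\<close> atoms of size \<open>16 ^ j\<close> have total mass
    \<open>4 * Q\<close>.\<close>
  have Q16: "4 * Q = 16 ^ J" by (simp add: Q J_def)
  have Q0: "Q > 0" by (simp add: Q)
  have I0: "I > 0" using I Q0 by simp
  obtain Y N :: "nat \<Rightarrow> nat \<Rightarrow> real" where YN: "\<And>e j. 0 \<le> Y e j" "\<And>e j. 0 \<le> N e j"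
    "\<And>j. Y 0 j \<noteq> 0 \<Longrightarrow> j = 0"
    "(\<Sum>e\<le>D + 1. \<Sum>j\<le>J. Y e j) = 1" "(\<Sum>e\<le>D + 1. \<Sum>j\<le>J. N e j) = 1" "1 - 2 * 24 ^ D / 4 ^ \<gamma> \<le> N 0 1"
    "\<And>f g :: real poly. degree f \<le> D \<Longrightarrow> degree g \<le> D \<Longrightarrow>
       (\<Sum>e\<le>D + 1. \<Sum>j\<le>J. Y e j * (poly f (shift_node D e) * poly g (16 ^ j))) =
       (\<Sum>e\<le>D + 1. \<Sum>j\<le>J. N e j * (poly f (shift_node D e) * poly g (16 ^ j)))"
    by (fact matching_weights[OF D J_def])
  define cs where "cs = I + 4 * Q + 2"
  have cs0: "cs > 0" by (simp add: cs_def)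
  define supp where "supp = (\<lambda>j. {S. S \<subseteq> {..<4 * Q} \<and> card S = 16 ^ (J - j)})"
  have fin_supp: "finite (supp j)" for j
    unfolding supp_def by (rule finite_subset[of _ "Pow {..<4 * Q}"]) auto
  have card_supp: "card (supp j) = 4 * Q choose 16 ^ (J - j)" for j
    by (simp add: supp_def n_subsets)
  have pow_le: "16 ^ (J - j) \<le> 4 * Q" for j unfolding Q16 by (rule power_increasing) auto
  have choose0: "real (4 * Q choose 16 ^ (J - j)) > 0" for j using pow_le[of j] by simp
  have mass: "real (16 ^ (J - j)) * 16 ^ j = 4 * real Q" if "j \<le> J" for j
  proof -
    have "real (16 ^ (J - j)) * 16 ^ j = real (16 ^ J)" using that by (simp flip: power_add)
    then show ?thesis by (simp flip: Q16)
  qed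
  \<comment> \<open>A state consists of the shift index, the exponent of the atom size and the
    support of the atoms; \<open>W\<close> spreads the weight of the first two uniformly over the
    supports.\<close>
  define Z where "Z = Sigma ({..D + 1} \<times> {..J}) (\<lambda>(e, j). supp j)"
  define \<mu> where "\<mu> = (\<lambda>((e, j), S) c. cell_mass Q I (shift_node D e) (16 ^ j) S c / (10 * real Q))"
  define W where "W = (\<lambda>(w :: nat \<Rightarrow> nat \<Rightarrow> real) ((e, j), S :: nat set). w e j / real (4 * Q choose 16 ^ (J - j)) :: real)"
  have finZ: "finite Z" unfolding Z_def using fin_supp by auto
  have sumZ: "(\<Sum>s\<in>Z. W w s * h s)
      = (\<Sum>e\<le>D + 1. \<Sum>j\<le>J. w e j * ((\<Sum>S\<in>supp j. h ((e, j), S)) / real (4 * Q choose 16 ^ (J - j))))" for w h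
  proof -
    have "(\<Sum>s\<in>Z. W w s * h s)
        = (\<Sum>p\<in>{..D + 1} \<times> {..J}. \<Sum>S\<in>supp (snd p). W w (p, S) * h (p, S))"
      unfolding Z_def case_prod_unfold using fin_supp
      by (subst sum.Sigma) (auto simp: case_prod_unfold)
    also have "\<dots> = (\<Sum>e\<le>D + 1. \<Sum>j\<le>J. \<Sum>S\<in>supp j. W w ((e, j), S) * h ((e, j), S))"
      by (simp only: sum.cartesian_product case_prod_unfold prod.collapse)
    finally show ?thesis by (simp add: W_def sum_distrib_left sum_divide_distrib)
  qed
  have W_one: "sum (W w) Z = 1" if "(\<Sum>e\<le>D + 1. \<Sum>j\<le>J. w e j) = 1" for w
    using sumZ[of w "\<lambda>_. 1"] that pow_le by (simp add: card_supp not_less[symmetric] del: sum.atMost_Suc)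
  have W_nonneg: "W w s \<ge> 0" if "\<And>e j. 0 \<le> w e j" for w s
    using that by (auto simp: W_def split: prod.splits)
  have node: "0 \<le> shift_node D e" "shift_node D e \<le> 3" if "e \<le> D + 1" for e
    using that D by (auto simp: shift_node_def field_simps)
  have \<mu>_nonneg: "\<mu> s c \<ge> 0" if "s \<in> Z" for s c
    using that node by (auto simp: Z_def \<mu>_def intro!: divide_nonneg_nonneg cell_mass_nonneg)
  have \<mu>_one: "(\<Sum>c<cs. \<mu> s c) = 1" if "s \<in> Z" for s
  proof -
    obtain e j S where s: "s = ((e, j), S)" "j \<le> J" "S \<subseteq> {..<4 * Q}" "card S = 16 ^ (J - j)"
      using \<open>s \<in> Z\<close> by (auto simp: Z_def supp_def)
    have "16 ^ j * real (card S) = 4 * real Q" using mass[OF s(2)] s(4) by (simp add: mult.commute)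
    then show ?thesis using sum_cell_mass[OF I0 s(3)] Q0
      by (simp add: s(1) \<mu>_def cs_def flip: sum_divide_distrib)
  qed
  have match: "(\<Sum>s\<in>Z. W Y s * prod_list (map (\<mu> s) us)) = (\<Sum>s\<in>Z. W N s * prod_list (map (\<mu> s) us))"
    if us: "set us \<subseteq> {..<cs}" "length us \<le> D" for us
  proof -
    obtain f g where fg: "degree f \<le> D" "degree g \<le> D"
      "\<And>a u M. real M * u = 4 * real Q \<Longrightarrow> M \<le> 4 * Q \<Longrightarrow>
        (\<Sum>S\<in>{S. S \<subseteq> {..<4 * Q} \<and> card S = M}. prod_list (map (cell_mass Q I a u S) us))
          / real (4 * Q choose M) = poly f a * poly g u"
      using mean_likelihood_poly[of us I Q D] us unfolding cs_def by blast
    have "(\<Sum>s\<in>Z. W w s * prod_list (map (\<mu> s) us))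
        = (\<Sum>e\<le>D + 1. \<Sum>j\<le>J. w e j * (poly f (shift_node D e) * poly g (16 ^ j))) / (10 * real Q) ^ length us" for w
    proof -
      have "(\<Sum>S\<in>supp j. prod_list (map (\<mu> ((e, j), S)) us)) / real (4 * Q choose 16 ^ (J - j))
          = poly f (shift_node D e) * poly g (16 ^ j) / (10 * real Q) ^ length us" if "j \<le> J" for e j
      proof -
        have "(\<Sum>S\<in>supp j. prod_list (map (\<mu> ((e, j), S)) us)) / real (4 * Q choose 16 ^ (J - j))
            = (\<Sum>S\<in>supp j. prod_list (map (cell_mass Q I (shift_node D e) (16 ^ j) S) us))
                / real (4 * Q choose 16 ^ (J - j)) / (10 * real Q) ^ length us"
          by (simp add: \<mu>_def prod_list_map_divide mult.commute flip: sum_divide_distrib)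
        then show ?thesis
          using fg(3)[OF mass[OF that] pow_le, of "shift_node D e"] by (simp only: supp_def)
      qed
      then show ?thesis unfolding sumZ by (simp add: sum_divide_distrib del: sum.atMost_Suc)
    qed
    then show ?thesis using YN(7)[OF fg(1,2)] by simp
  qed
  let ?p = "block_density b cs \<mu>" and ?q = "ref_distr b Q" and ?\<Omega> = "PiE {..<b} (\<lambda>_. Z)"
  have n_eq: "n = b * cs" by (simp add: n cs_def)
  have p_distr: "is_distr n (?p \<omega>)" if "\<omega> \<in> ?\<Omega>" for \<omega>
    using block_density_distr(1,2)[of Z cs \<mu> b \<omega>] \<mu>_nonneg \<mu>_one b that
    by (auto simp: is_distr_def n_eq)
  have T: "0 \<le> T xs \<and> T xs \<le> 1" for xs using solves by (simp add: solves_BinIdentity_def)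
  \<comment> \<open>A state of nonzero weight is either shifted or equal to \<open>(0, 0)\<close>.
    In the latter case the support has \<open>16 ^ J = 4 * Q\<close> elements and hence is the
    entire zone.\<close>
  have yes: "?p \<omega> \<in> P_q n k ?q" if \<omega>: "\<omega> \<in> ?\<Omega>" and Y\<omega>: "(\<Prod>a<b. W Y (\<omega> a)) \<noteq> 0" for \<omega>
  proof (rule mem_P_q_ref[OF b Q0 k p_distr[OF \<omega>]])
    fix i assume i: "i < b * (10 * Q)"
    define a where "a = i div (10 * Q)"
    have a: "a < b" using i by (simp add: a_def less_mult_imp_div_less)
    have "\<omega> a \<in> Z" using \<omega> a by auto
    then obtain e j S where s: "\<omega> a = ((e, j), S)" "e \<le> D + 1" "j \<le> J" "S \<subseteq> {..<4 * Q}" "card S = 16 ^ (J - j)"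
      by (auto simp: Z_def supp_def)
    have "W Y (\<omega> a) \<noteq> 0" using Y\<omega> a by auto
    then have "Y e j \<noteq> 0" by (auto simp: s W_def)
    then have j0: "e = 0 \<Longrightarrow> j = 0" using YN(3) by auto
    have "S = {..<4 * Q}" if "e = 0"
      using s(4,5) j0[OF that] Q16 by (intro card_subset_eq) auto
    then obtain x where x: "x \<le> cs" "(\<Sum>c<x. cell_mass Q I (shift_node D e) (16 ^ j) S c)
        = real (if i mod (10 * Q) < 3 * Q then 0 else min (i mod (10 * Q)) (4 * Q))"
      using shifted_block_visits[OF D Q0 I s(4,2), of "16 ^ j" "i mod (10 * Q)"] j0 unfolding cs_def by auto
    have "a * cs + x \<le> a * cs + cs" using x by simp
    also have "\<dots> = Suc a * cs" by simp
    also have "\<dots> \<le> n" unfolding n_eq using a by (intro mult_le_mono1) auto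
    finally have "a * cs + x \<le> n" .
    moreover have "sum (?p \<omega>) {1..a * cs + x} = (real a + (\<Sum>c<x. \<mu> (\<omega> a) c)) / real b"
    proof -
      have "(\<Sum>u<cs. \<mu> (\<omega> c) u) = 1" if "c < a" for c
      proof -
        have "c < b" using that a by simp
        then have "\<omega> c \<in> Z" using \<omega> by auto
        then show ?thesis by (rule \<mu>_one)
      qed
      then show ?thesis by (rule sum_prefix_block_density[of a b x cs \<mu> \<omega>, OF a x(1) cs0])
    qed
    moreover have "(\<Sum>c<x. \<mu> (\<omega> a) c)
        = real (if i mod (10 * Q) < 3 * Q then 0 else min (i mod (10 * Q)) (4 * Q)) / (10 * real Q)"
      by (simp add: s(1) \<mu>_def x(2) flip: sum_divide_distrib)
    moreover have "real (ref_cumulative b Q i)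
        = 10 * real Q * real a + real (if i mod (10 * Q) < 3 * Q then 0 else min (i mod (10 * Q)) (4 * Q))"
      using i by (simp add: ref_cumulative_def a_def)
    ultimately show "\<exists>x\<le>n. sum (?p \<omega>) {1..x} = real (ref_cumulative b Q i) / real (b * (10 * Q))"
      using b Q0 by (intro exI[of _ "a * cs + x"]) (simp add: field_simps)
  qed
  have Y_prod: "(\<Sum>\<omega>\<in>?\<Omega>. \<Prod>a<b. W Y (\<omega> a)) = 1" "(\<Sum>\<omega>\<in>?\<Omega>. \<Prod>a<b. W N (\<omega> a)) = 1"
    by (intro sum_PiE_prod_one finZ W_one YN)+
  have nonempty: "P_q n k ?q \<noteq> {}"
  proof -
    obtain \<omega> where "\<omega> \<in> ?\<Omega>" "(\<Prod>a<b. W Y (\<omega> a)) \<noteq> 0"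
      using Y_prod(1) by (metis (no_types, lifting) sum.neutral zero_neq_one)
    then show ?thesis using yes by blast
  qed
  have "2 / 3 \<le> (\<Sum>\<omega>\<in>?\<Omega>. (\<Prod>a<b. W Y (\<omega> a)) * accept_prob n m (?p \<omega>) T)"
  proof -
    have "2 / 3 = (\<Sum>\<omega>\<in>?\<Omega>. (\<Prod>a<b. W Y (\<omega> a)) * (2 / 3))"
      using Y_prod(1) by (simp flip: sum_distrib_right sum_divide_distrib)
    also have "\<dots> \<le> (\<Sum>\<omega>\<in>?\<Omega>. (\<Prod>a<b. W Y (\<omega> a)) * accept_prob n m (?p \<omega>) T)"
    proof (rule sum_mono)
      fix \<omega> assume \<omega>: "\<omega> \<in> ?\<Omega>"
      show "(\<Prod>a<b. W Y (\<omega> a)) * (2 / 3) \<le> (\<Prod>a<b. W Y (\<omega> a)) * accept_prob n m (?p \<omega>) T"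
      proof (cases "(\<Prod>a<b. W Y (\<omega> a)) = 0")
        case False
        then have "accept_prob n m (?p \<omega>) T \<ge> 2 / 3"
          using solves yes[OF \<omega>] p_distr[OF \<omega>] by (simp add: solves_BinIdentity_def)
        then show ?thesis by (intro mult_left_mono prod_nonneg W_nonneg YN) auto
      next
        case True
        show ?thesis unfolding True by simp
      qed
    qed
    finally show ?thesis .
  qed
  also have "\<dots> \<le> (\<Sum>\<omega>\<in>?\<Omega>. (\<Prod>a<b. W N (\<omega> a)) * accept_prob n m (?p \<omega>) T)
      + 3 * real b * (real m / real b) ^ Suc D"
    unfolding n_eq
    by (rule blocks_indistinguishable[OF finZ W_nonneg W_one W_nonneg W_one \<mu>_nonneg \<mu>_one match m(1) b T])
      (use YN in auto)
  also have "(\<Sum>\<omega>\<in>?\<Omega>. (\<Prod>a<b. W N (\<omega> a)) * accept_prob n m (?p \<omega>) T) \<le> 1 / 3 + 1 / 6"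
  proof -
    \<comment> \<open>The blocks outside state \<open>(0, 1)\<close>; under \<open>N\<close> their
      expected fraction is \<open>1 - N 0 1 \<le> 1 / 100\<close>.\<close>
    define rare where "rare = (\<lambda>s :: (nat \<times> nat) \<times> nat set. if fst s = (0, 1) then 0 else 1 :: real)"
    \<comment> \<open>A linear form of Markov's inequality. A rare fraction below
      \<open>3 / 50\<close> leaves distance above \<open>1 / 20 - 3 / 100 = 1 / 50\<close>;
      otherwise the right side already exceeds \<open>1\<close>. Its mean adds at most
      \<open>50 / 3 * (1 / 100) = 1 / 6\<close>.\<close>
    have accept: "accept_prob n m (?p \<omega>) T \<le> 1 / 3 + 50 / 3 * (\<Sum>a<b. rare (\<omega> a) / real b)"
      if \<omega>: "\<omega> \<in> ?\<Omega>" for \<omega>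
    proof (cases "(\<Sum>a<b. rare (\<omega> a) / real b) < 3 / 50")
      case True
      define E where "E = {i. fst (\<omega> ((i - 1) div cs)) \<noteq> (0, 1)}"
      have "sum (?p \<omega>) ({1..n} \<inter> E) = (\<Sum>i\<in>{1..n}. rare (\<omega> ((i - 1) div cs)) * ?p \<omega> i)"
        by (simp add: sum.inter_restrict, intro sum.cong) (auto simp: E_def rare_def)
      also have "\<dots> = (\<Sum>a<b. \<Sum>c<cs. rare (\<omega> a) * (\<mu> (\<omega> a) c / real b))"
        unfolding block_density_def n_eq by (rule sum_over_blocks)
      also have "\<dots> = (\<Sum>a<b. rare (\<omega> a) * ((\<Sum>c<cs. \<mu> (\<omega> a) c) / real b))"
        by (simp only: sum_distrib_left sum_divide_distrib)
      also have "\<dots> = (\<Sum>a<b. rare (\<omega> a) / real b)"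
      proof (rule sum.cong[OF refl])
        fix a assume "a \<in> {..<b}"
        then have "\<omega> a \<in> Z" using \<omega> by auto
        then show "rare (\<omega> a) * ((\<Sum>c<cs. \<mu> (\<omega> a) c) / real b) = rare (\<omega> a) / real b"
          by (simp add: \<mu>_one)
      qed
      finally have E: "sum (?p \<omega>) ({1..n} \<inter> E) < 3 / 50" using True by simp
      have "1 / 20 - sum (?p \<omega>) ({1..n} \<inter> E) / 2 \<le> dTV_set n (?p \<omega>) (P_q n k ?q)"
      proof (rule dTV_P_q_ref[OF b Q0 k p_distr[OF \<omega>] nonempty])
        fix i assume i: "i \<in> {1..n} - E"
        obtain S where S: "\<omega> ((i - 1) div cs) = ((0, 1), S)"
          using i unfolding E_def by (cases "\<omega> ((i - 1) div cs)") auto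
        \<comment> \<open>At shift \<open>0\<close> the first and the shadow cells are empty, atoms
          have mass \<open>16\<close>, and the last cell has mass \<open>6 * Q\<close>.\<close>
        have "cell_mass Q I 0 16 S c = 0 \<or> cell_mass Q I 0 16 S c \<ge> 2" for c
          using Q0 by (auto simp: cell_mass_def)
        moreover have "?p \<omega> i = cell_mass Q I 0 16 S ((i - 1) mod cs) / real (b * (10 * Q))"
          unfolding block_density_def S by (simp add: \<mu>_def shift_node_def mult_ac)
        ultimately show "?p \<omega> i = 0 \<or> 2 / real (b * (10 * Q)) \<le> ?p \<omega> i"
          by (metis divide_right_mono div_0 of_nat_0_le_iff)
      qed
      then have "dTV_set n (?p \<omega>) (P_q n k ?q) > 1 / 50" using E by simp
      then have "accept_prob n m (?p \<omega>) T \<le> 1 / 3"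
        using solves p_distr[OF \<omega>] by (simp add: solves_BinIdentity_def)
      moreover have "0 \<le> (\<Sum>a<b. rare (\<omega> a) / real b)" by (intro sum_nonneg) (auto simp: rare_def)
      ultimately show ?thesis by simp
    next
      case False
      moreover have "accept_prob n m (?p \<omega>) T \<le> 1"
        by (rule accept_prob_le_1[OF p_distr[OF \<omega>]]) (rule T)
      ultimately show ?thesis by linarith
    qed
    have "(\<Sum>\<omega>\<in>?\<Omega>. (\<Prod>a<b. W N (\<omega> a)) * accept_prob n m (?p \<omega>) T)
        \<le> (\<Sum>\<omega>\<in>?\<Omega>. (\<Prod>a<b. W N (\<omega> a)) * (1 / 3 + 50 / 3 * (\<Sum>a<b. rare (\<omega> a) / real b)))"
      by (intro sum_mono mult_left_mono accept prod_nonneg W_nonneg YN)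
    also have "\<dots> = 1 / 3 * (\<Sum>\<omega>\<in>?\<Omega>. \<Prod>a<b. W N (\<omega> a))
        + 50 / 3 * (\<Sum>a<b. \<Sum>\<omega>\<in>?\<Omega>. (\<Prod>a<b. W N (\<omega> a)) * (rare (\<omega> a) / real b))"
      by (subst sum.swap) (simp add: sum_distrib_left sum_divide_distrib sum.distrib algebra_simps)
    also have "\<dots> = 1 / 3 + 50 / 3 * (\<Sum>a<b. \<Sum>s\<in>Z. W N s * (rare s / real b))"
    proof -
      have "(\<Sum>\<omega>\<in>?\<Omega>. (\<Prod>a<b. W N (\<omega> a)) * (rare (\<omega> a) / real b)) = (\<Sum>s\<in>Z. W N s * (rare s / real b))"
        if "a < b" for a
        by (rule sum_PiE_prod_expectation[OF finZ W_one[OF YN(5)] that])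
      then show ?thesis using Y_prod(2) by (simp del: times_divide_eq_right)
    qed
    also have "(\<Sum>a<b. \<Sum>s\<in>Z. W N s * (rare s / real b)) = (\<Sum>s\<in>Z. W N s * rare s)"
      using b by (simp flip: sum_divide_distrib)
    also have "(\<Sum>s\<in>Z. W N s * rare s) = (\<Sum>e\<le>D + 1. \<Sum>j\<le>J. N e j * rare ((e, j), {}))"
    proof -
      have "(\<Sum>S\<in>supp j. rare ((e, j), S)) / real (4 * Q choose 16 ^ (J - j)) = rare ((e, j), {})" for e j
        using choose0[of j] by (simp add: rare_def card_supp)
      then show ?thesis by (simp add: sumZ)
    qed
    also have "\<dots> = (\<Sum>e\<le>D + 1. \<Sum>j\<le>J. N e j) - N 0 1"
    proof -
      have "(\<Sum>e\<le>D + 1. \<Sum>j\<le>J. N e j * rare ((e, j), {}))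
          = (\<Sum>e\<le>D + 1. \<Sum>j\<le>J. N e j) - (\<Sum>e\<le>D + 1. \<Sum>j\<le>J. if e = 0 \<and> j = 1 then N e j else 0)"
        unfolding sum_subtractf[symmetric] by (intro sum.cong) (auto simp: rare_def)
      also have "(\<Sum>e\<le>D + 1. \<Sum>j\<le>J. if e = 0 \<and> j = 1 then N e j else 0)
          = (\<Sum>e\<le>D + 1. if e = 0 then \<Sum>j\<le>J. if j = 1 then N e j else 0 else 0)"
        by (intro sum.cong) auto
      also have "\<dots> = N 0 1" by (simp add: J_def)
      finally show ?thesis .
    qed
    also have "\<dots> = 1 - N 0 1" by (simp only: YN(5))
    also have "\<dots> \<le> 1 / 100" using order.trans[OF diff_left_mono[OF \<theta>] YN(6)] by simp
    finally show ?thesis by simp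
  qed
  finally show False using m(2) by simp
qed

section \<open>Choice of the parameters\<close>

theorem theorem4:
  shows "\<exists>\<epsilon>0 > 0. \<exists>C > 0. \<exists>K0 \<ge> 1. \<forall>k \<ge> K0. \<exists>n q. is_distr k q \<and>
           (\<forall>m T. solves_BinIdentity n q k \<epsilon>0 m T \<longrightarrow>
               real m \<ge> real k / 2 powr (C * sqrt (log 2 (real k))))"
proof -
  \<comment> \<open>This threshold gives \<open>s \<ge> 40\<close>, which absorbs the additive
    constants in the exponents below.\<close>
  define K0 :: nat where "K0 = 2 ^ (40 * 40)"
  have main: "\<exists>n q. is_distr k q \<and> (\<forall>m T. solves_BinIdentity n q k (1 / 50) m T \<longrightarrow>
      real m \<ge> real k / 2 powr (20 * sqrt (log 2 (real k))))" if k: "k \<ge> K0" for k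
  proof -
    define s where "s = sqrt (log 2 (real k))"
    have k_pos: "real k > 0" using k by (simp add: K0_def)
    have "real K0 \<le> real k" using k by simp
    then have "real (40 * 40) \<le> log 2 (real k)"
      using k_pos unfolding K0_def by (subst le_log_iff) (simp_all add: powr_realpow del: power_numeral)
    then have s: "s \<ge> 40" unfolding s_def by (intro real_le_rsqrt) (simp add: power2_eq_square)
    have k_eq: "real k = 2 powr (s * s)"
    proof -
      have "log 2 (real k) \<ge> 0" using \<open>real (40 * 40) \<le> log 2 (real k)\<close> by simp
      then have "s * s = log 2 (real k)" by (simp add: s_def)
      then show ?thesis using k_pos by simp
    qed
    define D where "D = nat \<lceil>s\<rceil>"
    have D: "D > 0" "s \<le> real D" "real D \<le> s + 1" using s unfolding D_def by linarith+
    \<comment> \<open>Then \<open>4 ^ \<gamma> = 256 * 64 ^ D\<close> dominates the extrapolation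
      cost \<open>24 ^ D\<close> with a constant to spare.\<close>
    define \<gamma> where "\<gamma> = 3 * D + 4"
    define Q :: nat where "Q = 4 * 16 ^ (\<gamma> + D)"
    define b where "b = k div (10 * Q)"
    define n where "n = b * (Q * fact (3 * D) + 4 * Q + 2)"
    \<comment> \<open>The exponent is \<open>6 + 4 * (4 * D + 4) \<le> 16 * s + 38\<close>, which is
      at most \<open>17 * s\<close> for \<open>s \<ge> 40\<close>. The factorial enters only the
      domain size \<open>n\<close>, not the number of bins.\<close>
    have Q_le: "real (10 * Q) \<le> 2 powr (17 * s)"
    proof -
      have "real (10 * Q) \<le> 2 ^ 6 * 16 ^ (\<gamma> + D)" by (simp add: Q_def)
      also have "\<dots> = 2 ^ (6 + 4 * (\<gamma> + D))" by (simp add: power_add power_mult)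
      also have "\<dots> = 2 powr real (6 + 4 * (\<gamma> + D))" by (simp add: powr_realpow del: of_nat_add of_nat_mult)
      also have "\<dots> \<le> 2 powr (17 * s)" using D s by (intro powr_mono) (auto simp: \<gamma>_def)
      finally show ?thesis .
    qed
    \<comment> \<open>Rounding down in \<open>b\<close> costs at most a factor \<open>2\<close>,
      because \<open>2 * (10 * Q) \<le> k\<close>; this factor is absorbed by passing from
      \<open>17 * s\<close> to \<open>18 * s\<close>.\<close>
    have b_ge: "real b \<ge> real k / 2 powr (18 * s)"
    proof -
      have "2 powr (17 * s) * 2 \<le> 2 powr (18 * s)"
      proof -
        have "2 powr (17 * s) * 2 = 2 powr (17 * s + 1)" by (simp add: powr_add)
        also have "\<dots> \<le> 2 powr (18 * s)" using s by (intro powr_mono) auto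
        finally show ?thesis .
      qed
      also have "18 * s \<le> s * s" using s by (intro mult_right_mono) auto
      then have "2 powr (18 * s) \<le> real k" unfolding k_eq by (intro powr_mono) auto
      finally have big: "2 * real (10 * Q) \<le> real k" using Q_le by simp
      have "k < (b + 1) * (10 * Q)"
        unfolding b_def using dividend_less_div_times[of "10 * Q" k] by (simp add: Q_def)
      then have "real k < real ((b + 1) * (10 * Q))" by (simp only: of_nat_less_iff)
      then have "real k < real b * real (10 * Q) + real (10 * Q)" by (simp add: algebra_simps)
      then have "real k \<le> real b * (2 * real (10 * Q))" using big by linarith
      also have "\<dots> \<le> real b * 2 powr (18 * s)"
        using Q_le \<open>2 powr (17 * s) * 2 \<le> 2 powr (18 * s)\<close> by (intro mult_left_mono) auto
      finally show ?thesis by (simp add: field_simps)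
    qed
    have b0: "b > 0"
    proof -
      have "0 < real k / 2 powr (18 * s)" using k_pos by simp
      then show ?thesis using b_ge by (cases b) auto
    qed
    have b_le: "b * (10 * Q) \<le> k" unfolding b_def by (rule div_times_less_eq_dividend)
    have \<theta>: "2 * 24 ^ D / 4 ^ \<gamma> \<le> (1 / 100 :: real)"
    proof -
      have "(24::real) ^ D \<le> 64 ^ D" "(0::real) < 64 ^ D" by (auto intro: power_mono)
      then have "25 * (24::real) ^ D \<le> 32 * 64 ^ D" by linarith
      moreover have "(4::real) ^ \<gamma> = 64 ^ D * 256" by (simp add: \<gamma>_def power_add power_mult)
      ultimately show ?thesis by (simp add: field_simps)
    qed
    have "real m \<ge> real k / 2 powr (20 * s)" if solves: "solves_BinIdentity n (ref_distr b Q) k (1 / 50) m T" for m T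
    proof (rule ccontr)
      assume "\<not> real m \<ge> real k / 2 powr (20 * s)"
      then have "real m < real k / 2 powr (20 * s)" by simp
      also have "\<dots> = real k / 2 powr (18 * s) / 2 powr (2 * s)"
        by (simp flip: powr_add)
      also have "\<dots> \<le> real b / 2 powr (2 * s)" using b_ge by (intro divide_right_mono) auto
      finally have mb: "real m < real b / 2 powr (2 * s)" .
      then have ratio: "real m / real b \<le> 2 powr (- 2 * s)"
        using b0 by (simp add: field_simps powr_minus)
      have "2 powr (- 2 * s) \<le> 2 powr 0" using s by (intro powr_mono) auto
      then have "real m / real b \<le> 1" using ratio by simp
      then have "m \<le> b" using b0 by simp
      \<comment> \<open>The remaining factor \<open>2 powr (2 * s)\<close> in the sample bound,
        raised to a power \<open>Suc D \<ge> s\<close>, yields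
        \<open>2 powr (- 2 * (s * s)) = 1 / k ^ 2\<close>, which beats the number of blocks
        \<open>b \<le> k\<close>.\<close>
      moreover have "3 * real b * (real m / real b) ^ Suc D < 1 / 10"
      proof -
        have "(real m / real b) ^ Suc D \<le> (2 powr (- 2 * s)) ^ Suc D"
          using ratio by (intro power_mono) auto
        also have "\<dots> = 2 powr (- 2 * s * real (Suc D))" by (subst powr_realpow[symmetric]) (simp_all only: powr_powr, simp)
        also have "\<dots> \<le> 2 powr (- 2 * (s * s))"
        proof (intro powr_mono)
          have "s * s \<le> s * real (Suc D)" using D s by (intro mult_left_mono) auto
          then show "- 2 * s * real (Suc D) \<le> - 2 * (s * s)" by simp
        qed simp
        finally have "(real m / real b) ^ Suc D \<le> 2 powr (- 2 * (s * s))" .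
        moreover have "real b \<le> 2 powr (s * s)"
        proof -
          have "b \<le> k" unfolding b_def by (rule div_le_dividend)
          then show ?thesis using k_eq by simp
        qed
        ultimately have "3 * real b * (real m / real b) ^ Suc D \<le> 3 * 2 powr (s * s) * 2 powr (- 2 * (s * s))"
          by (intro mult_mono) auto
        also have "\<dots> = 3 * 2 powr (- (s * s))" by (simp flip: powr_add)
        also have "2 powr (- (s * s)) \<le> 2 powr (- 5)"
        proof (intro powr_mono)
          have "40 * 40 \<le> s * s" using s by (intro mult_mono) auto
          then show "- (s * s) \<le> - 5" by simp
        qed simp
        finally show ?thesis by (simp add: powr_minus)
      qed
      ultimately show False
        using no_tester[OF D(1) Q_def refl b0 b_le n_def \<theta>] solves by blast
    qed
    moreover have "is_distr k (ref_distr b Q)"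
      using ref_distr_is_distr[OF b0 _ b_le] by (simp add: Q_def)
    ultimately show ?thesis unfolding s_def by blast
  qed
  have "K0 \<ge> 1" by (simp add: K0_def)
  then have "\<exists>K0 \<ge> 1. \<forall>k \<ge> K0. \<exists>n q. is_distr k q \<and> (\<forall>m T. solves_BinIdentity n q k (1 / 50) m T \<longrightarrow>
      real m \<ge> real k / 2 powr (20 * sqrt (log 2 (real k))))"
    using main by blast
  moreover have "(0::real) < 1 / 50" "(0::real) < 20" by simp_all
  ultimately show ?thesis by blast
qed

end
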